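(* Let $A\subset\mathbb{P}$ be a set of primes whose natural density in $\mathbb{P}$ is $D_{\text{nat-prime}}(A)=\theta\in(0,1]$. Then: (i) $$\lim_{N\to\infty}\frac{\sum_{n\in\mathbb{N}:\ p\mid n\Rightarrow p\le N\text{ and } p\in A}\frac1n}{\sum_{n\le N:\ p\mid n\Rightarrow p\in A}\frac1n}=e^{\gamma\theta}\,\Gamma(\theta+1);$$ (ii) for every integer $k\ge2$, $$\lim_{N\to\infty}\frac{\sum^{'(k)}_{n\in\mathbb{N}:\ p\mid n\Rightarrow p\le N\text{ and } p\in A}\frac1n}{\sum^{'(k)}_{n\le N:\ p\mid n\Rightarrow p\in A}\frac1n}=e^{\gamma\theta}\,\Gamma(\theta+1).$$
   Context: $\mathbb{P}$ denotes the set of primes. The natural density of $A\subset\mathbb{P}$ in $\mathbb{P}$ is $D_{\text{nat-prime}}(A)=\lim_{N\to\infty}\frac{|A\cap\{1,\dots,N\}|}{|\mathbb{P}\cap\{1,\dots,N\}|}$, assumed to exist. In the sums, $p$ ranges over primes, so e.g. the condition "$p\mid n\Rightarrow p\le N$ and $p\in A$" means every prime divisor of $n$ is at most $N$ and lies in $A$ (the integer $n=1$ is included). For $k\ge2$, a positive integer $n$ is $k$-free if $p^k\nmid n$ for every prime $p$, and $\sum^{'(k)}_B$ denotes the sum restricted to the $k$-free integers in the indicated set $B$. $\gamma$ is the Euler–Mascheroni constant and $\Gamma(x)=\int_0^\infty t^{x-1}e^{-t}\,dt$ is the Gamma function. *)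

theory Defs
  imports "HOL-Analysis.Analysis" "HOL-Computational_Algebra.Primes"
begin

definition has_prime_density :: "nat set \<Rightarrow> real \<Rightarrow> bool" where
  "has_prime_density A \<theta> \<longleftrightarrow>
     (\<lambda>N. real (card (A \<inter> {1..N})) / real (card ({p. prime p} \<inter> {1..N}))) \<longlonglongrightarrow> \<theta>"

(* Without n > 0 the set would contain 0 when P contains all primes. *)
definition integers_over :: "nat set \<Rightarrow> nat set" where
  "integers_over P = {n. n > 0 \<and> (\<forall>p. prime p \<longrightarrow> p dvd n \<longrightarrow> p \<in> P)}"

definition k_free :: "nat \<Rightarrow> nat \<Rightarrow> bool" where
  "k_free k n \<longleftrightarrow> n > 0 \<and> (\<forall>p. prime p \<longrightarrow> \<not> p ^ k dvd n)"

end

theory Submission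
  imports Defs
begin

text \<open>
  Write \<open>F(s)\<close> for the sum of \<open>1 / n^(1 + s)\<close> over the integers in question. By the Euler product,
  \<open>ln F(s)\<close> is the prime sum \<open>H(s)\<close> of \<open>1 / p^(1 + s)\<close>, \<open>p \<in> A\<close>, plus a term that is continuous
  at \<open>s = 0\<close>. For all primes, \<open>s \<zeta>(1 + s) \<longlonglongrightarrow> 1\<close> gives \<open>H(a s) - H(b s) \<longlonglongrightarrow> ln (b / a)\<close>, and Abel
  summation transfers this to \<open>A\<close> with the factor \<open>\<theta>\<close>; no prime number theorem is needed.

  These limits are the moments of the measures with mass \<open>p^(-1-s) - p^(-1-2s)\<close> at \<open>p^(-s)\<close>, so
  Karamata's method (Weierstrass approximation) applies with \<open>s = 1 / ln N\<close> and yields that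
  \<open>H(s)\<close> minus the sum of \<open>1 / p\<close> over \<open>p \<le> N\<close> tends to \<open>- \<gamma> \<theta>\<close>, i.e. the product over
  \<open>p \<le> N\<close> is asymptotic to \<open>exp (\<gamma> \<theta>) F(s)\<close>. The same method with mass \<open>n^(-1-s) / F(s)\<close> at
  \<open>n^(-s)\<close>, whose moments tend to \<open>(1 + j) powr (- \<theta>)\<close>, shows that the sum over \<open>n \<le> N\<close> is
  asymptotic to \<open>F(s) / \<Gamma>(\<theta> + 1)\<close>.
\<close>

subsection \<open>Gamma integrals\<close>

text \<open>For a nonnegative integrand the gauge integral is also the Lebesgue integral. This
  brings \<open>Gamma_integral_real\<close> and the power integral into a setting where dominated
  convergence applies.\<close>

lemma has_bochner_integral_from_has_integral:
  fixes f :: "real \<Rightarrow> real"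
  assumes "(f has_integral I) S" "\<And>x. x \<in> S \<Longrightarrow> 0 \<le> f x"
    and [measurable]: "f \<in> borel_measurable borel" "S \<in> sets borel"
  shows "has_bochner_integral lborel (\<lambda>x. indicator S x * f x) I"
proof (rule has_bochner_integral_nn_integral)
  show "0 \<le> I" using assms(1,2) by (rule has_integral_nonneg)
  show "AE x in lborel. 0 \<le> indicator S x * f x"
    using assms(2) by (auto simp: indicator_def)
  have "integral\<^sup>N lborel (\<lambda>x. ennreal (indicator S x * f x)) = 
        integral\<^sup>N lborel (\<lambda>x. indicator S x * ennreal (f x))"
    by (intro nn_integral_cong) (auto simp: indicator_def)
  moreover have "integral\<^sup>N lborel (\<lambda>x. indicator S x * f x) = I"
    by (rule nn_integral_has_integral_lebesgue) (use assms in auto)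
  ultimately show "(\<integral>\<^sup>+ x. ennreal (indicator S x * f x) \<partial>lborel) = ennreal I" by simp
qed measurable

lemma has_bochner_integral_powr_unit:
  assumes "\<theta> > (0::real)"
  shows "has_bochner_integral lborel (\<lambda>u. indicator {0..1} u * u powr (\<theta> - 1)) (1 / \<theta>)"
proof -
  have "((\<lambda>u. u powr (\<theta> - 1)) has_integral 1 powr (\<theta> - 1 + 1) / (\<theta> - 1 + 1)) {0..1}"
    using assms by (intro has_integral_powr_from_0) auto
  then show ?thesis by (intro has_bochner_integral_from_has_integral) auto
qed

text \<open>Substitution of \<open>a * u\<close> in Euler's integral, rescaled by
  \<open>a powr (1 - x)\<close>. As \<open>a\<close> varies this is the Laplace transform of a Gamma
  density, the source of the moments \<open>(1 + real j) powr (- \<theta>)\<close>.\<close>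

lemma has_bochner_integral_Gamma:
  fixes a x :: real
  assumes "a > 0" "x > 0"
  shows "has_bochner_integral lborel
           (\<lambda>u. indicator {0<..} u * (u powr (x - 1) * exp (- (a * u)))) (Gamma x * a powr (- x))"
proof -
  have "has_bochner_integral lborel
          (\<lambda>u. indicator {0..} u * (u powr (x - 1) / exp u)) (Gamma x)"
    by (intro has_bochner_integral_from_has_integral Gamma_integral_real assms) auto
  then have "has_bochner_integral lborel (\<lambda>u. indicator {0..} (0 + a * u) *
      ((0 + a * u) powr (x - 1) / exp (0 + a * u))) (Gamma x /\<^sub>R \<bar>a\<bar>)"
    using assms by (subst lborel_has_bochner_integral_real_affine_iff[symmetric]) auto
  then have *: "has_bochner_integral lborel (\<lambda>u. a powr (1 - x) * (indicator {0..} (0 + a * u) *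
      ((0 + a * u) powr (x - 1) / exp (0 + a * u)))) (a powr (1 - x) * (Gamma x /\<^sub>R \<bar>a\<bar>))"
    by (intro has_bochner_integral_mult_right) auto
  have c: "a powr (1 - x) * (Gamma x /\<^sub>R \<bar>a\<bar>) = Gamma x * a powr (- x)"
    using assms by (simp add: powr_diff powr_minus field_simps)
  have eq: "a powr (1 - x) * (indicator {0..} (0 + a * u) *
      ((0 + a * u) powr (x - 1) / exp (0 + a * u))) =
      indicator {0<..} u * (u powr (x - 1) * exp (- (a * u)))" for u
  proof (cases "u > 0")
    case True
    then show ?thesis using assms
      by (simp add: powr_mult exp_minus field_simps flip: powr_add)
  next
    case False
    then show ?thesis using assms by (auto simp: indicator_def zero_le_mult_iff)
  qed
  show ?thesis using * unfolding eq c .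
qed

text \<open>The majorant is a combination of the Gamma integrands with \<open>x = 1\<close> and
  \<open>x = 2\<close>. The linear factor \<open>1 + u\<close> leaves room to dominate
  \<open>u powr \<epsilon>\<close> for \<epsilon> < 1.\<close>

lemma integrable_exp_bound:
  fixes f :: "real \<Rightarrow> real"
  assumes "a > 0" and [measurable]: "f \<in> borel_measurable borel"
    and "\<And>u. u > 0 \<Longrightarrow> \<bar>f u\<bar> \<le> C * (1 + u) * exp (- (a * u))"
  shows "integrable lborel (\<lambda>u. indicator {0<..} u * f u)"
proof (rule Bochner_Integration.integrable_bound)
  have "integrable lborel (\<lambda>u. C * (indicator {0<..} u * (u powr (1 - 1) * exp (- (a * u))) +
           indicator {0<..} u * (u powr (2 - 1) * exp (- (a * u)))))"
    using assms(1) has_bochner_integral_Gamma[of a 1] has_bochner_integral_Gamma[of a 2]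
    by (intro integrable_mult_right integrable_add) (auto simp: has_bochner_integral_iff)
  then show "integrable lborel (\<lambda>u. indicator {0<..} u * (C * (1 + u) * exp (- (a * u))))"
    by (rule back_subst[where P = "integrable lborel"])
       (auto simp: fun_eq_iff indicator_def algebra_simps)
  show "AE u in lborel. norm (indicator {0<..} u * f u) \<le>
           norm (indicator {0<..} u * (C * (1 + u) * exp (- (a * u))))"
    using assms(3) by (auto simp: indicator_def intro!: AE_I2 intro: order_trans[OF _ abs_ge_self])
qed measurable

text \<open>Evaluates an integral whose integrand \<open>\<phi>\<close> has only the apparent singularity
  \<open>1/u\<close> at 0 by splitting \<open>u powr \<epsilon> * \<phi> u\<close> into Gamma integrals and letting \<open>\<epsilon>\<close> tend to 0.\<close>
lemma has_bochner_integral_regularised: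
  fixes \<phi> :: "real \<Rightarrow> real"
  assumes a: "a > 0" and [measurable]: "\<phi> \<in> borel_measurable borel"
    and bnd: "\<And>u. u > 0 \<Longrightarrow> \<bar>\<phi> u\<bar> \<le> C * exp (- (a * u))"
    and J: "\<And>\<epsilon>. 0 < \<epsilon> \<Longrightarrow> \<epsilon> < 1 \<Longrightarrow>
          has_bochner_integral lborel (\<lambda>u. indicator {0<..} u * (u powr \<epsilon> * \<phi> u)) (J \<epsilon>)"
    and lim: "(J \<longlongrightarrow> c) (at_right 0)"
  shows "has_bochner_integral lborel (\<lambda>u. indicator {0<..} u * \<phi> u) c"
proof -
  have C: "C \<ge> 0" using bnd[of 1] by (smt (verit) exp_gt_zero mult_neg_pos)
  \<comment> \<open>Dominated convergence is applied along a sequence; the shift by 2 keeps even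
    \<open>e 0\<close> strictly below 1, as the hypothesis on \<open>J\<close> requires.\<close>
  define e where "e n = 1 / real (n + 2)" for n
  have e: "0 < e n" "e n < 1" for n by (auto simp: e_def)
  have e': "e n \<noteq> 0" for n using e(1)[of n] by linarith
  have e0: "e \<longlonglongrightarrow> 0" unfolding e_def by real_asymp
  have int: "integrable lborel (\<lambda>u. indicator {0<..} u * \<phi> u)"
    using a bnd C by (intro integrable_exp_bound[where a=a and C=C])
      (auto intro: order_trans[OF bnd] mult_right_mono simp: algebra_simps)
  have "(\<lambda>n. integral\<^sup>L lborel (\<lambda>u. indicator {0<..} u * (u powr e n * \<phi> u)))
      \<longlonglongrightarrow> integral\<^sup>L lborel (\<lambda>u. indicator {0<..} u * \<phi> u)"
  proof (rule integral_dominated_convergence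
      [where w = "\<lambda>u. indicator {0<..} u * (C * (1 + u) * exp (- (a * u)))"])
    show "integrable lborel (\<lambda>u. indicator {0<..} u * (C * (1 + u) * exp (- (a * u))))"
      using a C by (intro integrable_exp_bound[where a=a and C=C]) (auto simp: abs_mult)
    show "AE u in lborel. (\<lambda>n. indicator {0<..} u * (u powr e n * \<phi> u))
              \<longlonglongrightarrow> indicator {0<..} u * \<phi> u"
    proof (intro AE_I2)
      fix u :: real
      have "(\<lambda>n. indicator {0<..} u * (u powr e n * \<phi> u))
              \<longlonglongrightarrow> indicator {0<..} u * (u powr 0 * \<phi> u)" if "u > 0"
        using that by (intro tendsto_intros e0) auto
      then show "(\<lambda>n. indicator {0<..} u * (u powr e n * \<phi> u))
              \<longlonglongrightarrow> indicator {0<..} u * \<phi> u"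
        by (cases "u > 0") auto
    qed
    show "AE u in lborel. norm (indicator {0<..} u * (u powr e n * \<phi> u)) \<le>
             indicator {0<..} u * (C * (1 + u) * exp (- (a * u)))" for n
    proof (intro AE_I2)
      fix u :: real
      have "u powr e n * \<bar>\<phi> u\<bar> \<le> (1 + u) * (C * exp (- (a * u)))" if "u > 0"
      proof (intro mult_mono bnd that)
        \<comment> \<open>Passing through \<open>1 + u\<close> covers \<open>u < 1\<close> and
          \<open>u > 1\<close> at once.\<close>
        have "u powr e n \<le> (1 + u) powr e n" using that e[of n] by (intro powr_mono2) auto
        also have "\<dots> \<le> (1 + u) powr 1" using that e[of n] by (intro powr_mono) auto
        finally show "u powr e n \<le> 1 + u" using that by simp
      qed (use that in auto)
      then show "norm (indicator {0<..} u * (u powr e n * \<phi> u)) \<le>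
             indicator {0<..} u * (C * (1 + u) * exp (- (a * u)))"
        by (cases "u > 0") (auto simp: abs_mult algebra_simps)
    qed
  qed measurable
  moreover have "integral\<^sup>L lborel (\<lambda>u. indicator {0<..} u * (u powr e n * \<phi> u)) = J (e n)" for n
    using J[OF e] by (rule has_bochner_integral_integral_eq)
  moreover have "(\<lambda>n. J (e n)) \<longlonglongrightarrow> c"
    by (rule filterlim_compose[OF lim])
       (use e e0 e' in \<open>auto simp: filterlim_at intro!: always_eventually\<close>)
  ultimately have "integral\<^sup>L lborel (\<lambda>u. indicator {0<..} u * \<phi> u) = c"
    using LIMSEQ_unique by simp
  with int show ?thesis by (simp add: has_bochner_integral_iff)
qed

section \<open>Frullani's integral and an integral for the Euler-Mascheroni constant\<close>

lemma Gamma_plus1_over: "x > 0 \<Longrightarrow> Gamma x = Gamma (1 + x) / (x::real)"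
  using Gamma_plus1[of x] by (force simp: field_simps add.commute)

lemma tendsto_Gamma_at_1: "((\<lambda>\<epsilon>. Gamma (1 + \<epsilon>)) \<longlongrightarrow> (1::real)) (at_right 0)"
proof -
  have "isCont (\<lambda>\<epsilon>. Gamma (1 + \<epsilon>)) (0::real)"
    by (intro continuous_intros) auto
  then show ?thesis by (auto simp: isCont_def intro: tendsto_mono[OF at_le])
qed

text \<open>With \<open>a = 1 + real j\<close> and \<open>b = 2 + real j\<close> this is, up to the
  factor \<theta>, the \<open>j\<close>-th moment of the limit measure behind
  \<open>dseries_truncation\<close>.\<close>

lemma has_bochner_integral_Frullani_exp:
  fixes a b :: real
  assumes "0 < a" "a \<le> b"
  shows "has_bochner_integral lborel
           (\<lambda>u. indicator {0<..} u * ((exp (- (a * u)) - exp (- (b * u))) / u)) (ln (b / a))"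
proof (rule has_bochner_integral_regularised[where a = a and C = "b - a" and
         J = "\<lambda>\<epsilon>. Gamma \<epsilon> * a powr (- \<epsilon>) - Gamma \<epsilon> * b powr (- \<epsilon>)"])
  fix u :: real assume u: "u > 0"
  have "1 - exp (- ((b - a) * u)) \<le> (b - a) * u"
    using exp_ge_add_one_self[of "- ((b - a) * u)"] by linarith
  then have "exp (- (a * u)) * (1 - exp (- ((b - a) * u))) \<le> exp (- (a * u)) * ((b - a) * u)"
    by (intro mult_left_mono) auto
  moreover have "exp (- (a * u)) * (1 - exp (- ((b - a) * u))) = exp (- (a * u)) - exp (- (b * u))"
    by (simp add: algebra_simps flip: exp_add)
  moreover have "exp (- (b * u)) \<le> exp (- (a * u))" using assms u by simp
  ultimately show "\<bar>(exp (- (a * u)) - exp (- (b * u))) / u\<bar> \<le> (b - a) * exp (- (a * u))"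
    using u by (simp add: field_simps)
next
  fix \<epsilon> :: real assume e: "0 < \<epsilon>" "\<epsilon> < 1"
  have "has_bochner_integral lborel
     (\<lambda>u. indicator {0<..} u * (u powr (\<epsilon> - 1) * exp (- (a * u))) -
          indicator {0<..} u * (u powr (\<epsilon> - 1) * exp (- (b * u))))
     (Gamma \<epsilon> * a powr (- \<epsilon>) - Gamma \<epsilon> * b powr (- \<epsilon>))"
    using assms e by (intro has_bochner_integral_diff has_bochner_integral_Gamma) auto
  then show "has_bochner_integral lborel
      (\<lambda>u. indicator {0<..} u * (u powr \<epsilon> * ((exp (- (a * u)) - exp (- (b * u))) / u)))
      (Gamma \<epsilon> * a powr (- \<epsilon>) - Gamma \<epsilon> * b powr (- \<epsilon>))"
    by (rule has_bochner_integral_cong[THEN iffD1, rotated -1])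
       (auto simp: indicator_def powr_diff field_simps)
next
  \<comment> \<open>The pole of \<open>Gamma\<close> at 0 is absorbed:
    \<open>Gamma \<epsilon> = Gamma (1 + \<epsilon>) / \<epsilon>\<close> turns \<open>J\<close>
    into \<open>Gamma (1 + \<epsilon>)\<close> times a difference quotient at 0.\<close>
  have "((\<lambda>\<epsilon>. Gamma (1 + \<epsilon>) * ((a powr (- \<epsilon>) - b powr (- \<epsilon>)) / \<epsilon>))
          \<longlongrightarrow> 1 * (ln b - ln a)) (at_right 0)"
  proof (rule tendsto_mult[OF tendsto_Gamma_at_1])
    have "((\<lambda>\<epsilon>. a powr (- \<epsilon>) - b powr (- \<epsilon>)) has_real_derivative
            (a powr (- 0) * ((- 1) * ln a) - b powr (- 0) * ((- 1) * ln b))) (at 0)"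
      using assms by (auto intro!: derivative_eq_intros)
    then have "((\<lambda>\<epsilon>. (a powr (- \<epsilon>) - b powr (- \<epsilon>)) / \<epsilon>) \<longlongrightarrow> ln b - ln a) (at 0)"
      using assms by (simp add: DERIV_def)
    then show "((\<lambda>\<epsilon>. (a powr (- \<epsilon>) - b powr (- \<epsilon>)) / \<epsilon>) \<longlongrightarrow> ln b - ln a) (at_right 0)"
      by (rule tendsto_mono[OF at_le, rotated]) auto
  qed
  moreover have "\<forall>\<^sub>F \<epsilon> in at_right 0. Gamma (1 + \<epsilon>) * ((a powr (- \<epsilon>) - b powr (- \<epsilon>)) / \<epsilon>) =
        Gamma \<epsilon> * a powr (- \<epsilon>) - Gamma \<epsilon> * b powr (- \<epsilon>)"
    using eventually_at_right_less[of 0]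
  proof eventually_elim
    case (elim \<epsilon>)
    then show ?case by (simp add: Gamma_plus1_over[OF elim] field_simps)
  qed
  ultimately have "((\<lambda>\<epsilon>. Gamma \<epsilon> * a powr (- \<epsilon>) - Gamma \<epsilon> * b powr (- \<epsilon>))
      \<longlongrightarrow> 1 * (ln b - ln a)) (at_right 0)"
    by (rule Lim_transform_eventually)
  then show "((\<lambda>\<epsilon>. Gamma \<epsilon> * a powr (- \<epsilon>) - Gamma \<epsilon> * b powr (- \<epsilon>))
      \<longlongrightarrow> ln (b / a)) (at_right 0)"
    using assms by (simp add: ln_div)
qed (use assms in auto)

text \<open>After multiplication by \<open>u powr \<epsilon>\<close> the two parts integrate to
  \<open>Gamma \<epsilon>\<close> and \<open>1 / \<epsilon>\<close>. Their difference is the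
  difference quotient of \<open>Gamma\<close> at 1, and the derivative there is
  \<open>- euler_mascheroni\<close>.\<close>

lemma has_bochner_integral_euler_mascheroni:
  "has_bochner_integral lborel
     (\<lambda>u. indicator {0<..} u * ((exp (- u) - indicator {..1} u) / u)) (- euler_mascheroni :: real)"
proof (rule has_bochner_integral_regularised[where a = 1 and C = "exp 1" and
         J = "\<lambda>\<epsilon>. Gamma \<epsilon> - 1 / \<epsilon>"])
  fix u :: real assume u: "u > 0"
  \<comment> \<open>The factor \<open>exp 1\<close> makes the bound at least 1 for
    \<open>u \<le> 1\<close>, where the quotient is at most 1 in absolute value.\<close>
  show "\<bar>(exp (- u) - indicator {..1} u) / u\<bar> \<le> exp 1 * exp (- (1 * u))"
  proof (cases "u \<le> 1")
    case True
    have "1 - exp (- u) \<le> u" using exp_ge_add_one_self[of "-u"] by linarith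
    then have "\<bar>(exp (- u) - indicator {..1} u) / u\<bar> \<le> 1" using u True by (simp add: field_simps)
    also have "\<dots> \<le> exp (1 - u)" using True by simp
    finally show ?thesis by (simp flip: exp_add)
  next
    case False
    then have "exp (- u) / u \<le> exp (- u) / 1" by (intro divide_left_mono) auto
    also have "\<dots> \<le> exp 1 * exp (- u)" by (simp flip: exp_add)
    finally show ?thesis using False by simp
  qed
next
  fix \<epsilon> :: real assume e: "0 < \<epsilon>" "\<epsilon> < 1"
  with has_bochner_integral_Gamma[of 1 \<epsilon>] has_bochner_integral_powr_unit[of \<epsilon>]
  have "has_bochner_integral lborel
     (\<lambda>u. indicator {0<..} u * (u powr (\<epsilon> - 1) * exp (- (1 * u))) -
          indicator {0..1} u * u powr (\<epsilon> - 1))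
     (Gamma \<epsilon> * 1 powr (- \<epsilon>) - 1 / \<epsilon>)"
    using e by (intro has_bochner_integral_diff) auto
  then show "has_bochner_integral lborel
      (\<lambda>u. indicator {0<..} u * (u powr \<epsilon> * ((exp (- u) - indicator {..1} u) / u)))
      (Gamma \<epsilon> - 1 / \<epsilon>)"
    by (rule has_bochner_integral_cong[THEN iffD1, rotated -1])
       (auto simp: indicator_def powr_diff field_simps)
next
  have "((\<lambda>\<epsilon>. (Gamma (1 + \<epsilon>) - Gamma 1) / \<epsilon>) \<longlongrightarrow> - euler_mascheroni) (at (0::real))"
    using has_field_derivative_Gamma[of "1::real" UNIV] by (simp add: DERIV_def)
  then have "((\<lambda>\<epsilon>. (Gamma (1 + \<epsilon>) - Gamma 1) / \<epsilon>) \<longlongrightarrow> - euler_mascheroni) (at_right (0::real))"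
    by (rule tendsto_mono[OF at_le, rotated]) auto
  moreover have "\<forall>\<^sub>F \<epsilon> in at_right (0::real). (Gamma (1 + \<epsilon>) - Gamma 1) / \<epsilon> = Gamma \<epsilon> - 1 / \<epsilon>"
    using eventually_at_right_less[of 0]
  proof eventually_elim
    case (elim \<epsilon>)
    then show ?case by (simp add: Gamma_plus1_over[OF elim] field_simps)
  qed
  ultimately show "((\<lambda>\<epsilon>. Gamma \<epsilon> - 1 / \<epsilon>) \<longlongrightarrow> - euler_mascheroni) (at_right (0::real))"
    by (rule Lim_transform_eventually)
qed auto

subsection \<open>The method of moments on the unit interval\<close>

text \<open>This stands for the image under \<open>X\<close> of the measure with density
  \<open>d\<close>, a finite measure on the unit interval. Keeping \<open>M\<close>,
  \<open>d\<close> and \<open>X\<close> separate lets sums over \<open>nat\<close> and Lebesgue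
  integrals be compared without forming image measures.\<close>

definition weighted_unit :: "'a measure \<Rightarrow> ('a \<Rightarrow> real) \<Rightarrow> ('a \<Rightarrow> real) \<Rightarrow> bool" where
  "weighted_unit M d X \<longleftrightarrow> integrable M d \<and> (\<forall>x. 0 \<le> d x) \<and>
     X \<in> borel_measurable M \<and> (\<forall>x. X x \<in> {0..1})"

lemma weighted_unit_integrable:
  assumes "weighted_unit M d X" and [measurable]: "g \<in> borel_measurable borel"
    and B: "\<And>t. t \<in> {0..1} \<Longrightarrow> \<bar>g t\<bar> \<le> B"
  shows "integrable M (\<lambda>x. d x * g (X x))"
proof (rule Bochner_Integration.integrable_bound)
  have [measurable]: "X \<in> borel_measurable M" "d \<in> borel_measurable M"
    using assms(1) by (auto simp: weighted_unit_def)
  show "integrable M (\<lambda>x. B * d x)" using assms(1) by (auto simp: weighted_unit_def)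
  show "(\<lambda>x. d x * g (X x)) \<in> borel_measurable M" by measurable
  have "\<bar>d x * g (X x)\<bar> \<le> \<bar>B * d x\<bar>" for x
  proof -
    have "\<bar>d x * g (X x)\<bar> \<le> d x * B" using assms(1) B[of "X x"]
      by (auto simp: abs_mult weighted_unit_def intro!: mult_left_mono)
    then show ?thesis by (simp add: mult.commute)
  qed
  then show "AE x in M. norm (d x * g (X x)) \<le> norm (B * d x)" by simp
qed

lemma continuous_bounded_on_unit:
  fixes g :: "real \<Rightarrow> real"
  assumes "continuous_on UNIV g"
  obtains B where "B \<ge> 0" "\<And>t. t \<in> {0..1} \<Longrightarrow> \<bar>g t\<bar> \<le> B"
proof -
  have "bounded (g ` {0..1})"
    by (intro compact_imp_bounded compact_continuous_image continuous_on_subset[OF assms]) auto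
  then obtain B where "\<And>t. t \<in> {0..1} \<Longrightarrow> \<bar>g t\<bar> \<le> B" by (force simp: bounded_iff)
  then show ?thesis using that[of B] by (metis abs_ge_zero atLeastAtMost_iff order.trans order_refl zero_le_one)
qed

lemma weighted_unit_integrable_continuous:
  fixes g :: "real \<Rightarrow> real"
  assumes "weighted_unit M d X" "continuous_on UNIV g"
  shows "integrable M (\<lambda>x. d x * g (X x))"
  using continuous_bounded_on_unit[OF assms(2)]
    weighted_unit_integrable[OF assms(1) borel_measurable_continuous_onI[OF assms(2)]] by metis

lemma weighted_unit_diff_le:
  assumes "weighted_unit M d X"
    and "integrable M (\<lambda>x. d x * g (X x))" "integrable M (\<lambda>x. d x * p (X x))"
        "integrable M (\<lambda>x. d x * b (X x))"
    and "\<And>t. t \<in> {0..1} \<Longrightarrow> \<bar>g t - p t\<bar> \<le> b t"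
  shows "\<bar>(\<integral>x. d x * g (X x) \<partial>M) - (\<integral>x. d x * p (X x) \<partial>M)\<bar> \<le> (\<integral>x. d x * b (X x) \<partial>M)"
proof -
  have "(\<integral>x. d x * g (X x) \<partial>M) - (\<integral>x. d x * p (X x) \<partial>M) =
      (\<integral>x. d x * g (X x) - d x * p (X x) \<partial>M)"
    using assms by simp
  also have "\<bar>\<dots>\<bar> \<le> (\<integral>x. \<bar>d x * g (X x) - d x * p (X x)\<bar> \<partial>M)"
    by (rule integral_abs_bound)
  also have "\<dots> \<le> (\<integral>x. d x * b (X x) \<partial>M)"
  proof (rule integral_mono)
    fix x
    have "\<bar>d x * g (X x) - d x * p (X x)\<bar> = d x * \<bar>g (X x) - p (X x)\<bar>"
      using assms(1) by (simp add: weighted_unit_def abs_mult flip: right_diff_distrib)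
    also have "\<dots> \<le> d x * b (X x)"
      using assms by (intro mult_left_mono) (auto simp: weighted_unit_def)
    finally show "\<bar>d x * g (X x) - d x * p (X x)\<bar> \<le> d x * b (X x)" .
  qed (use assms in auto)
  finally show ?thesis .
qed

context
  fixes M :: "'a measure" and d X :: "'s \<Rightarrow> 'a \<Rightarrow> real" and F :: "'s filter"
    and K :: "'b measure" and e Y :: "'b \<Rightarrow> real"
  assumes ev: "\<forall>\<^sub>F s in F. weighted_unit M (d s) (X s)" and lim: "weighted_unit K e Y"
begin

text \<open>A three-epsilon argument. The error is controlled by a function \<open>b\<close> with
  small limiting integral instead of a uniform constant, since a discontinuous \<open>g\<close> can
  be approximated uniformly only away from its jump.\<close>

lemma weighted_limit_approx:
  assumes g: "g \<in> borel_measurable borel" "\<And>t. t \<in> {0..1} \<Longrightarrow> \<bar>g t\<bar> \<le> B"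
    and ap: "\<And>\<delta>. \<delta> > 0 \<Longrightarrow> \<exists>p b. continuous_on UNIV p \<and> continuous_on UNIV b \<and>
          ((\<lambda>s. \<integral>x. d s x * p (X s x) \<partial>M) \<longlongrightarrow> (\<integral>x. e x * p (Y x) \<partial>K)) F \<and>
          ((\<lambda>s. \<integral>x. d s x * b (X s x) \<partial>M) \<longlongrightarrow> (\<integral>x. e x * b (Y x) \<partial>K)) F \<and>
          (\<forall>t\<in>{0..1}. \<bar>g t - p t\<bar> \<le> b t) \<and> (\<integral>x. e x * b (Y x) \<partial>K) < \<delta>"
  shows "((\<lambda>s. \<integral>x. d s x * g (X s x) \<partial>M) \<longlongrightarrow> (\<integral>x. e x * g (Y x) \<partial>K)) F"
proof (rule tendstoI)
  fix \<epsilon> :: real assume "\<epsilon> > 0"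
  with ap[of "\<epsilon> / 3"] obtain p b where c: "continuous_on UNIV p" "continuous_on UNIV b" and
    pl: "((\<lambda>s. \<integral>x. d s x * p (X s x) \<partial>M) \<longlongrightarrow> (\<integral>x. e x * p (Y x) \<partial>K)) F" and
    bl: "((\<lambda>s. \<integral>x. d s x * b (X s x) \<partial>M) \<longlongrightarrow> (\<integral>x. e x * b (Y x) \<partial>K)) F" and
    bnd: "\<And>t. t \<in> {0..1} \<Longrightarrow> \<bar>g t - p t\<bar> \<le> b t" and small: "(\<integral>x. e x * b (Y x) \<partial>K) < \<epsilon> / 3"
    by auto
  have K: "\<bar>(\<integral>x. e x * g (Y x) \<partial>K) - (\<integral>x. e x * p (Y x) \<partial>K)\<bar> \<le> (\<integral>x. e x * b (Y x) \<partial>K)"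
    by (rule weighted_unit_diff_le[OF lim weighted_unit_integrable[OF lim g]
        weighted_unit_integrable_continuous[OF lim c(1)]
        weighted_unit_integrable_continuous[OF lim c(2)] bnd])
  have "\<forall>\<^sub>F s in F. dist (\<integral>x. d s x * p (X s x) \<partial>M) (\<integral>x. e x * p (Y x) \<partial>K) < \<epsilon> / 3"
    using \<open>\<epsilon> > 0\<close> by (intro tendstoD[OF pl]) auto
  with ev order_tendstoD(2)[OF bl small]
  show "\<forall>\<^sub>F s in F. dist (\<integral>x. d s x * g (X s x) \<partial>M) (\<integral>x. e x * g (Y x) \<partial>K) < \<epsilon>"
  proof eventually_elim
    case (elim s)
    have "\<bar>(\<integral>x. d s x * g (X s x) \<partial>M) - (\<integral>x. d s x * p (X s x) \<partial>M)\<bar>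
        \<le> (\<integral>x. d s x * b (X s x) \<partial>M)"
      by (rule weighted_unit_diff_le[OF elim(1) weighted_unit_integrable[OF elim(1) g]
          weighted_unit_integrable_continuous[OF elim(1) c(1)]
          weighted_unit_integrable_continuous[OF elim(1) c(2)] bnd])
    then show ?case using K elim(2,3) small unfolding dist_real_def by linarith
  qed
qed

context
  assumes mom: "\<And>j. ((\<lambda>s. \<integral>x. d s x * X s x ^ j \<partial>M) \<longlongrightarrow> (\<integral>x. e x * Y x ^ j \<partial>K)) F"
begin

lemma weighted_limit_poly:
  "((\<lambda>s. \<integral>x. d s x * (\<Sum>i\<le>n. a i * X s x ^ i) \<partial>M) \<longlongrightarrow> (\<integral>x. e x * (\<Sum>i\<le>n. a i * Y x ^ i) \<partial>K)) F"
proof -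
  \<comment> \<open>Stated for an arbitrary weight, so that it serves the approximating measures and
    the limit alike.\<close>
  have eq: "(\<integral>x. e x * (\<Sum>i\<le>n. a i * Y x ^ i) \<partial>K) = (\<Sum>i\<le>n. a i * (\<integral>x. e x * Y x ^ i \<partial>K))"
    if "weighted_unit K e Y" for K :: "'c measure" and e Y
  proof -
    have "integrable K (\<lambda>x. e x * Y x ^ i)" for i
      by (rule weighted_unit_integrable_continuous[OF that]) (intro continuous_intros)
    then have "(\<integral>x. (\<Sum>i\<le>n. a i * (e x * Y x ^ i)) \<partial>K) = (\<Sum>i\<le>n. a i * (\<integral>x. e x * Y x ^ i \<partial>K))"
      by (subst Bochner_Integration.integral_sum) auto
    then show ?thesis by (simp add: sum_distrib_left algebra_simps)
  qed
  have "((\<lambda>s. \<Sum>i\<le>n. a i * (\<integral>x. d s x * X s x ^ i \<partial>M)) \<longlongrightarrow>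
      (\<Sum>i\<le>n. a i * (\<integral>x. e x * Y x ^ i \<partial>K))) F"
    by (intro tendsto_intros mom)
  moreover have "\<forall>\<^sub>F s in F. (\<Sum>i\<le>n. a i * (\<integral>x. d s x * X s x ^ i \<partial>M)) =
      (\<integral>x. d s x * (\<Sum>i\<le>n. a i * X s x ^ i) \<partial>M)"
    using ev by eventually_elim (rule eq[symmetric])
  ultimately show ?thesis by (subst eq[OF lim]) (rule Lim_transform_eventually)
qed

text \<open>Weierstrass approximation. The majorant is a constant, whose integrals are multiples of
  the zeroth moments and therefore converge too.\<close>

lemma weighted_limit_continuous:
  assumes "continuous_on UNIV g"
  shows "((\<lambda>s. \<integral>x. d s x * g (X s x) \<partial>M) \<longlongrightarrow> (\<integral>x. e x * g (Y x) \<partial>K)) F"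
proof -
  obtain B where B: "\<And>t. t \<in> {0..1} \<Longrightarrow> \<bar>g t\<bar> \<le> B"
    using continuous_bounded_on_unit[OF assms] by auto
  define m where "m = (\<integral>x. e x \<partial>K)"
  have "m \<ge> 0" unfolding m_def using lim by (intro Bochner_Integration.integral_nonneg) (auto simp: weighted_unit_def)
  show ?thesis
  proof (rule weighted_limit_approx[OF borel_measurable_continuous_onI[OF assms] B])
    fix \<delta> :: real assume "\<delta> > 0"
    \<comment> \<open>The denominator \<open>m + 1\<close> gives
      \<open>m * \<eta> < \<delta>\<close> also when the total mass \<open>m\<close> is 0.\<close>
    define \<eta> where "\<eta> = \<delta> / (m + 1)"
    have \<eta>: "\<eta> > 0" "m * \<eta> < \<delta>" using \<open>\<delta> > 0\<close> \<open>m \<ge> 0\<close> by (auto simp: \<eta>_def field_simps)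
    obtain p where "real_polynomial_function p" and p: "\<And>t. t \<in> {0..1} \<Longrightarrow> \<bar>g t - p t\<bar> < \<eta>"
      using Stone_Weierstrass_real_polynomial_function[OF compact_Icc _ \<eta>(1), of 0 1 g]
        continuous_on_subset[OF assms] by (metis subset_UNIV)
    then obtain a n where a: "p = (\<lambda>x. \<Sum>i\<le>n. a i * x ^ i)"
      unfolding real_polynomial_function_iff_sum by blast
    have "((\<lambda>s. (\<integral>x. d s x * X s x ^ 0 \<partial>M) * \<eta>) \<longlongrightarrow> (\<integral>x. e x * Y x ^ 0 \<partial>K) * \<eta>) F"
      by (intro tendsto_intros mom)
    then show "\<exists>p b. continuous_on UNIV p \<and> continuous_on UNIV b \<and>
          ((\<lambda>s. \<integral>x. d s x * p (X s x) \<partial>M) \<longlongrightarrow> (\<integral>x. e x * p (Y x) \<partial>K)) F \<and>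
          ((\<lambda>s. \<integral>x. d s x * b (X s x) \<partial>M) \<longlongrightarrow> (\<integral>x. e x * b (Y x) \<partial>K)) F \<and>
          (\<forall>t\<in>{0..1}. \<bar>g t - p t\<bar> \<le> b t) \<and> (\<integral>x. e x * b (Y x) \<partial>K) < \<delta>"
      using weighted_limit_poly[of a n] p \<eta>
      by (intro exI[of _ p] exI[of _ "\<lambda>_. \<eta>"])
         (force simp: a m_def intro!: continuous_intros less_imp_le)
  qed
qed

text \<open>Karamata's step: a jump at \<open>c\<close> is harmless because the limit measure gives
  the point \<open>c\<close> no mass.\<close>

lemma weighted_limit_piecewise:
  assumes g: "continuous_on UNIV g1" "continuous_on UNIV g2"
    and c: "AE x in K. Y x \<noteq> c"
  shows "((\<lambda>s. \<integral>x. d s x * (if X s x < c then g1 (X s x) else g2 (X s x)) \<partial>M)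
           \<longlongrightarrow> (\<integral>x. e x * (if Y x < c then g1 (Y x) else g2 (Y x)) \<partial>K)) F"
proof -
  have [measurable]: "g1 \<in> borel_measurable borel" "g2 \<in> borel_measurable borel"
    using g by (auto intro: borel_measurable_continuous_onI)
  have [measurable]: "Y \<in> borel_measurable K" "e \<in> borel_measurable K"
    and Y: "\<And>x. Y x \<in> {0..1}" and e: "\<And>x. e x \<ge> 0" "integrable K e"
    using lim by (auto simp: weighted_unit_def)
  obtain B1 where B1: "B1 \<ge> 0" "\<And>t. t \<in> {0..1} \<Longrightarrow> \<bar>g1 t\<bar> \<le> B1"
    using continuous_bounded_on_unit[OF g(1)] by auto
  obtain B2 where B2: "B2 \<ge> 0" "\<And>t. t \<in> {0..1} \<Longrightarrow> \<bar>g2 t\<bar> \<le> B2"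
    using continuous_bounded_on_unit[OF g(2)] by auto
  define B where "B = B1 + B2"
  \<comment> \<open>For \<open>m > 0\<close> the function \<open>hat m\<close> rises linearly from 0
    at \<open>c - 1 / m\<close> to 1 at \<open>c\<close>, so \<open>p m\<close> bridges the jump on
    that interval and equals \<open>g2\<close> from \<open>c\<close> on. The error stays below the
    tent \<open>b m\<close> of half-width \<open>1 / m\<close>.\<close>
  define hat where "hat m t = min 1 (max 0 (1 + real m * (t - c)))" for m :: nat and t :: real
  define b where "b m t = B * max 0 (1 - real m * \<bar>t - c\<bar>)" for m :: nat and t :: real
  define p where "p m t = g1 t + (g2 t - g1 t) * hat m t" for m t
  have cont: "continuous_on UNIV (p m)" "continuous_on UNIV (b m)" for m
    unfolding p_def[abs_def] b_def[abs_def] hat_def by (intro continuous_intros g)+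
  have [measurable]: "b m \<in> borel_measurable borel" for m
    using cont(2) by (rule borel_measurable_continuous_onI)
  \<comment> \<open>The tents shrink to the point \<open>c\<close>, which \<open>Y\<close> avoids
    almost everywhere.\<close>
  have b0: "(\<lambda>m. \<integral>x. e x * b m (Y x) \<partial>K) \<longlonglongrightarrow> (\<integral>x. 0 \<partial>K)"
  proof (rule integral_dominated_convergence[where w = "\<lambda>x. B * e x"])
    have *: "(\<lambda>m. e x * b m (Y x)) \<longlonglongrightarrow> 0" if "Y x \<noteq> c" for x
    proof (rule tendsto_eventually)
      have "filterlim (\<lambda>m. real m * \<bar>Y x - c\<bar>) at_top sequentially"
        using that by (intro filterlim_at_top_mult_tendsto_pos[OF tendsto_const] filterlim_real_sequentially) auto
      then have "\<forall>\<^sub>F m in sequentially. real m * \<bar>Y x - c\<bar> \<ge> 1"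
        by (simp add: filterlim_at_top)
      then show "\<forall>\<^sub>F m in sequentially. e x * b m (Y x) = 0"
        by eventually_elim (simp add: b_def)
    qed
    from c show "AE x in K. (\<lambda>m. e x * b m (Y x)) \<longlonglongrightarrow> 0"
      by eventually_elim (rule *)
    have "e x * \<bar>b m (Y x)\<bar> \<le> e x * B" for m x
      using e B1(1) B2(1) by (intro mult_left_mono) (auto simp: b_def B_def abs_mult intro!: mult_left_le)
    then show "AE x in K. norm (e x * b m (Y x)) \<le> B * e x" for m
      using e by (simp add: abs_mult mult.commute)
  qed (use e in auto)
  show ?thesis
  proof (rule weighted_limit_approx[where g = "\<lambda>t. if t < c then g1 t else g2 t" and B = B])
    fix \<delta> :: real assume "\<delta> > 0"
    with order_tendstoD(2)[OF b0, of \<delta>] obtain m where m: "(\<integral>x. e x * b m (Y x) \<partial>K) < \<delta>"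
      by (auto dest: eventually_happens)
    have "\<bar>(if t < c then g1 t else g2 t) - p m t\<bar> \<le> b m t" if "t \<in> {0..1}" for t
    proof (cases "t < c")
      case True
      then have hat: "hat m t = max 0 (1 - real m * \<bar>t - c\<bar>)"
        using mult_nonneg_nonpos[of "real m" "t - c"] by (simp add: hat_def algebra_simps)
      have "\<bar>(g2 t - g1 t) * hat m t\<bar> = \<bar>g2 t - g1 t\<bar> * hat m t"
        by (simp add: abs_mult hat)
      also have "\<dots> \<le> B * hat m t"
        using B1(2)[OF that] B2(2)[OF that] by (intro mult_right_mono) (auto simp: B_def hat)
      finally show ?thesis using True by (simp add: p_def b_def hat)
    next
      case False
      then have "hat m t = 1" by (simp add: hat_def)
      then show ?thesis using False B1(1) B2(1) by (simp add: p_def b_def B_def)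
    qed
    then show "\<exists>p b. continuous_on UNIV p \<and> continuous_on UNIV b \<and>
          ((\<lambda>s. \<integral>x. d s x * p (X s x) \<partial>M) \<longlongrightarrow> (\<integral>x. e x * p (Y x) \<partial>K)) F \<and>
          ((\<lambda>s. \<integral>x. d s x * b (X s x) \<partial>M) \<longlongrightarrow> (\<integral>x. e x * b (Y x) \<partial>K)) F \<and>
          (\<forall>t\<in>{0..1}. \<bar>(if t < c then g1 t else g2 t) - p t\<bar> \<le> b t) \<and>
          (\<integral>x. e x * b (Y x) \<partial>K) < \<delta>"
      using m cont weighted_limit_continuous
      by (intro exI[of _ "p m"] exI[of _ "b m"]) auto
  next
    fix t :: real assume "t \<in> {0..1}"
    then show "\<bar>if t < c then g1 t else g2 t\<bar> \<le> B"
      using B1 B2 by (fastforce simp: B_def)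
  qed measurable
qed

end

end

subsection \<open>Dirichlet series and Abel summation\<close>

text \<open>The index 0 contributes nothing, even if it lies in \<open>A\<close>, because
  \<open>0 powr x = 0\<close>.\<close>

definition dseries :: "nat set \<Rightarrow> real \<Rightarrow> real" where
  "dseries A \<sigma> = (\<Sum>n. indicator A n * real n powr (- \<sigma>))"

lemma summable_dseries:
  assumes "\<sigma> > 1"
  shows "summable (\<lambda>n. indicator A n * real n powr (- \<sigma>))"
proof (rule summable_comparison_test)
  show "summable (\<lambda>n. real n powr (- \<sigma>))"
    using assms by (simp add: summable_real_powr_iff)
qed (auto simp: indicator_def)

text \<open>Comparison with the integral of \<open>x powr (- (1 + s))\<close> gives
  \<open>1 / s \<le> dseries {1..} (1 + s) \<le> 1 + 1 / s\<close>.\<close>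

lemma dseries_zeta_asymp: "((\<lambda>s. s * dseries {1..} (1 + s)) \<longlongrightarrow> 1) (at_right 0)"
proof (rule tendsto_sandwich)
  have bnd: "1 \<le> s * dseries {1..} (1 + s) \<and> s * dseries {1..} (1 + s) \<le> 1 + s"
    if s: "s > 0" for s :: real
  proof -
    define f where "f n = real (Suc n) powr (- (1 + s))" for n
    \<comment> \<open>\<open>g n\<close> is the integral of \<open>x powr (- (1 + s))\<close> from
      \<open>n + 1\<close> to infinity. By the mean value theorem its decrements lie between
      consecutive terms of the series.\<close>
    define g where "g n = real (Suc n) powr (- s) / s" for n
    have sm: "summable (\<lambda>n. indicator {1..} n * real n powr (- (1 + s)))"
      using s by (intro summable_dseries) auto
    have "(\<lambda>n. indicator {1..} n * real n powr (- (1 + s))) sums dseries {1..} (1 + s)"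
      unfolding dseries_def using sm by (rule summable_sums)
    then have "(\<lambda>n. indicator {1..} (Suc n) * real (Suc n) powr (- (1 + s))) sums dseries {1..} (1 + s)"
      by (subst sums_Suc_iff) simp
    then have f: "f sums dseries {1..} (1 + s)" by (simp add: f_def[abs_def])
    have "g \<longlonglongrightarrow> 0" unfolding g_def using s by real_asymp
    then have g: "(\<lambda>n. g n - g (Suc n)) sums (1 / s)"
      using telescope_sums'[of g 0] by (simp add: g_def)
    have step: "f (Suc n) \<le> g n - g (Suc n)" "g n - g (Suc n) \<le> f n" for n
    proof -
      have "\<exists>z::real. z > real (Suc n) \<and> z < real (Suc (Suc n)) \<and>
         real (Suc (Suc n)) powr (- s) / s - real (Suc n) powr (- s) / s =
           (real (Suc (Suc n)) - real (Suc n)) * - (z powr (- (1 + s)))"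
        using s by (intro MVT2) (auto intro!: derivative_eq_intros simp: field_simps powr_diff powr_minus)
      then obtain z where z: "real (Suc n) < z" "z < real (Suc (Suc n))"
        "g n - g (Suc n) = z powr (- (1 + s))" by (auto simp: g_def)
      show "f (Suc n) \<le> g n - g (Suc n)" "g n - g (Suc n) \<le> f n"
        unfolding z(3) f_def using z(1,2) s by (auto intro!: powr_mono2')
    qed
    have "1 / s \<le> dseries {1..} (1 + s)"
      by (rule sums_le[OF _ g f]) (rule step)
    moreover have "dseries {1..} (1 + s) - f 0 \<le> 1 / s"
      by (rule sums_le[OF step(1) _ g]) (use f in \<open>simp add: sums_Suc_iff\<close>)
    ultimately show ?thesis using s by (simp add: f_def field_simps)
  qed
  have pos: "\<forall>\<^sub>F s::real in at_right 0. s > 0" by (rule eventually_at_right_less)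
  show "\<forall>\<^sub>F s in at_right 0. 1 \<le> s * dseries {1..} (1 + s)"
       "\<forall>\<^sub>F s in at_right 0. s * dseries {1..} (1 + s) \<le> 1 + s"
    using pos by (auto elim!: eventually_mono dest: bnd)
  show "((\<lambda>s::real. 1 + s) \<longlongrightarrow> 1) (at_right 0)"
    by (auto intro!: tendsto_eq_intros)
qed simp

section \<open>Abel summation and the transfer from all primes to a set of given density\<close>

lemma Abel_lower_bound:
  fixes D w :: "nat \<Rightarrow> real"
  assumes D: "\<And>n. n \<ge> m \<Longrightarrow> (\<Sum>i\<le>n. D i) \<ge> 0"
    and w: "\<And>i. w i \<ge> 0" "\<And>i. i \<ge> m \<Longrightarrow> w (Suc i) \<le> w i" and "m \<le> n"
  shows "(\<Sum>i\<le>m. D i * w i) - (\<Sum>i\<le>m. D i) * w m \<le> (\<Sum>i\<le>n. D i * w i)"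
proof -
  \<comment> \<open>From \<open>m\<close> on, the weighted sum minus its boundary term is
    nondecreasing: each step adds a nonnegative partial sum of \<open>D\<close> times a decrement of
    \<open>w\<close>.\<close>
  have "(\<Sum>i\<le>m. D i * w i) - (\<Sum>i\<le>m. D i) * w m \<le> (\<Sum>i\<le>n. D i * w i) - (\<Sum>i\<le>n. D i) * w n"
    using \<open>m \<le> n\<close>
  proof (induction n rule: dec_induct)
    case (step n)
    have "(\<Sum>i\<le>n. D i) * w (Suc n) \<le> (\<Sum>i\<le>n. D i) * w n"
      using step D w by (intro mult_left_mono) auto
    with step.IH show ?case by (simp add: algebra_simps)
  qed simp
  moreover have "0 \<le> (\<Sum>i\<le>n. D i) * w n" using D[OF \<open>m \<le> n\<close>] w(1) by simp
  ultimately show ?thesis by linarith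
qed

text \<open>The partial sums of \<open>\<delta> b \<plusminus> (a - \<theta> b)\<close> are eventually nonnegative, so Abel summation
  bounds the corresponding weighted sums from below by finitely many terms.\<close>
lemma weighted_sum_transfer:
  fixes a b :: "nat \<Rightarrow> real" and w :: "'s \<Rightarrow> nat \<Rightarrow> real"
  assumes dens: "((\<lambda>n. (\<Sum>i\<le>n. a i) / (\<Sum>i\<le>n. b i)) \<longlonglongrightarrow> \<theta>)"
    and bpos: "\<forall>\<^sub>F n in sequentially. (\<Sum>i\<le>n. b i) > 0"
    and w: "\<forall>\<^sub>F s in F. (\<forall>n. w s n \<ge> 0) \<and> (\<forall>n\<ge>k. w s (Suc n) \<le> w s n) \<and>
              summable (\<lambda>n. a n * w s n) \<and> summable (\<lambda>n. b n * w s n)"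
    and w0: "\<And>n. ((\<lambda>s. w s n) \<longlongrightarrow> 0) F"
    and L: "((\<lambda>s. \<Sum>n. b n * w s n) \<longlongrightarrow> L) F"
  shows "((\<lambda>s. \<Sum>n. a n * w s n) \<longlongrightarrow> \<theta> * L) F"
proof -
  define SA SB where "SA s = (\<Sum>n. a n * w s n)" and "SB s = (\<Sum>n. b n * w s n)" for s
  have "((\<lambda>s. SA s - \<theta> * SB s) \<longlongrightarrow> 0) F"
  proof (rule tendstoI)
    fix \<epsilon> :: real assume \<epsilon>: "\<epsilon> > 0"
    \<comment> \<open>Half of \<epsilon> pays for \<delta> times the sum over \<open>b\<close>,
      which is eventually below \<open>\<bar>L\<bar> + 1\<close>; the other half pays for the
      boundary terms.\<close>
    define \<delta> where "\<delta> = \<epsilon> / (2 * (\<bar>L\<bar> + 1))"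
    have \<delta>: "\<delta> > 0" "\<delta> * (\<bar>L\<bar> + 1) = \<epsilon> / 2" using \<epsilon> by (auto simp: \<delta>_def field_simps)
    \<comment> \<open>The sign \<eta> is 1 or -1, so that a single lower bound yields both estimates
      for \<open>SA s - \<theta> * SB s\<close>.\<close>
    define D where "D \<eta> i = \<delta> * b i + \<eta> * (a i - \<theta> * b i)" for \<eta> :: real and i
    have "\<forall>\<^sub>F n in sequentially. \<bar>(\<Sum>i\<le>n. a i) - \<theta> * (\<Sum>i\<le>n. b i)\<bar> \<le> \<delta> * (\<Sum>i\<le>n. b i)"
      using tendstoD[OF dens \<delta>(1)] bpos
    proof eventually_elim
      case (elim n)
      define x y where "x = (\<Sum>i\<le>n. a i)" and "y = (\<Sum>i\<le>n. b i)"
      have "\<bar>x / y - \<theta>\<bar> * y \<le> \<delta> * y"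
        using elim unfolding x_def[symmetric] y_def[symmetric]
        by (intro mult_right_mono) (auto simp: dist_real_def)
      moreover have "\<bar>x / y - \<theta>\<bar> * y = \<bar>x - \<theta> * y\<bar>"
        using elim(2) unfolding y_def[symmetric] by (simp add: abs_mult_pos' field_simps)
      ultimately show ?case by (simp add: x_def y_def)
    qed
    then obtain m0 where m0: "\<And>n. n \<ge> m0 \<Longrightarrow>
        \<bar>(\<Sum>i\<le>n. a i) - \<theta> * (\<Sum>i\<le>n. b i)\<bar> \<le> \<delta> * (\<Sum>i\<le>n. b i)"
      by (auto simp: eventually_sequentially)
    \<comment> \<open>From \<open>m\<close> on both the density estimate and the monotonicity of the
      weights hold.\<close>
    define m where "m = max m0 k"
    have Dpos: "(\<Sum>i\<le>n. D \<eta> i) \<ge> 0" if "n \<ge> m" "\<eta> \<in> {-1, 1}" for \<eta> n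
    proof -
      have "(\<Sum>i\<le>n. D \<eta> i) = \<delta> * (\<Sum>i\<le>n. b i) + \<eta> * ((\<Sum>i\<le>n. a i) - \<theta> * (\<Sum>i\<le>n. b i))"
        by (simp add: D_def sum.distrib sum_subtractf flip: sum_distrib_left)
      then show ?thesis using m0[of n] that by (auto simp: m_def)
    qed
    \<comment> \<open>This is what Abel summation leaves over: a finite combination of weights, each
      of which tends to 0.\<close>
    define r where "r \<eta> s = (\<Sum>i\<le>m. D \<eta> i * w s i) - (\<Sum>i\<le>m. D \<eta> i) * w s m" for \<eta> s
    have r0: "(r \<eta> \<longlongrightarrow> 0) F" for \<eta>
    proof -
      have "(r \<eta> \<longlongrightarrow> (\<Sum>i\<le>m. D \<eta> i * 0) - (\<Sum>i\<le>m. D \<eta> i) * 0) F"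
        unfolding r_def[abs_def] by (intro tendsto_intros w0)
      then show ?thesis by simp
    qed
    have "\<forall>\<^sub>F s in F. \<bar>r \<eta> s\<bar> < \<epsilon> / 2" for \<eta>
      using tendstoD[OF r0, of "\<epsilon> / 2" \<eta>] \<epsilon> by simp
    moreover have "\<forall>\<^sub>F s in F. \<bar>SB s - L\<bar> < 1"
      using tendstoD[OF L, of 1] by (simp add: SB_def dist_real_def)
    ultimately have "\<forall>\<^sub>F s in F. \<bar>r 1 s\<bar> < \<epsilon> / 2 \<and> \<bar>r (- 1) s\<bar> < \<epsilon> / 2 \<and> \<bar>SB s - L\<bar> < 1"
      by (intro eventually_conj)
    with w show "\<forall>\<^sub>F s in F. dist (SA s - \<theta> * SB s) 0 < \<epsilon>"
    proof eventually_elim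
      case (elim s)
      have "r \<eta> s \<le> \<delta> * SB s + \<eta> * (SA s - \<theta> * SB s)" if "\<eta> \<in> {-1, 1}" for \<eta>
      proof (rule LIMSEQ_le_const)
        have "(\<lambda>i. b i * w s i) sums SB s" "(\<lambda>i. a i * w s i) sums SA s"
          using elim(1) by (auto simp: SA_def SB_def)
        then have "(\<lambda>i. \<delta> * (b i * w s i) + \<eta> * (a i * w s i - \<theta> * (b i * w s i))) sums
            (\<delta> * SB s + \<eta> * (SA s - \<theta> * SB s))"
          by (intro sums_add sums_diff sums_mult)
        then have "(\<lambda>i. D \<eta> i * w s i) sums (\<delta> * SB s + \<eta> * (SA s - \<theta> * SB s))"
          by (simp add: D_def algebra_simps)
        then show "(\<lambda>n. \<Sum>i\<le>n. D \<eta> i * w s i) \<longlonglongrightarrow> \<delta> * SB s + \<eta> * (SA s - \<theta> * SB s)"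
          by (simp add: sums_def_le)
        show "\<exists>N. \<forall>n\<ge>N. r \<eta> s \<le> (\<Sum>i\<le>n. D \<eta> i * w s i)"
          unfolding r_def using elim(1) that
          by (intro exI[of _ m] allI impI Abel_lower_bound Dpos) (auto simp: m_def)
      qed
      from this[of 1] this[of "- 1"]
      have "\<bar>SA s - \<theta> * SB s\<bar> < \<delta> * SB s + \<epsilon> / 2" using elim(2) by auto
      also have "\<delta> * SB s \<le> \<delta> * (\<bar>L\<bar> + 1)" using \<delta> elim(2) by (intro mult_left_mono) auto
      finally show ?case using \<delta> by simp
    qed
  qed
  moreover have "((\<lambda>s. \<theta> * SB s) \<longlongrightarrow> \<theta> * L) F"
    unfolding SB_def by (intro tendsto_intros L)
  ultimately have "((\<lambda>s. (SA s - \<theta> * SB s) + \<theta> * SB s) \<longlongrightarrow> 0 + \<theta> * L) F"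
    by (rule tendsto_add)
  then show ?thesis by (simp add: SA_def)
qed

text \<open>The difference vanishes at 1, so it cannot be expected to decrease from the start. The
  sign of its derivative reduces to \<open>1 + \<beta> \<le> (1 + \<alpha>) * z powr (\<beta> -
  \<alpha>)\<close>, for which \<open>ln z \<ge> 1\<close> suffices; 3 is the first integer above
  e.\<close>

lemma powr_diff_antimono:
  fixes \<alpha> \<beta> x y :: real
  assumes "0 \<le> \<alpha>" "\<alpha> \<le> \<beta>" "3 \<le> x" "x \<le> y"
  shows "y powr (- (1 + \<alpha>)) - y powr (- (1 + \<beta>)) \<le> x powr (- (1 + \<alpha>)) - x powr (- (1 + \<beta>))"
proof (rule DERIV_nonpos_imp_nonincreasing[OF \<open>x \<le> y\<close>])
  fix z :: real assume z: "x \<le> z" "z \<le> y"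
  then have z3: "z \<ge> 3" using assms by simp
  have "1 + \<beta> \<le> (1 + \<alpha>) * (1 + (\<beta> - \<alpha>))"
    using assms by (simp add: algebra_simps mult_left_mono)
  also have "\<dots> \<le> (1 + \<alpha>) * z powr (\<beta> - \<alpha>)"
  proof (rule mult_left_mono)
    have "1 \<le> ln z" using z3 exp_le by (subst ln_ge_iff) auto
    then have "\<beta> - \<alpha> \<le> (\<beta> - \<alpha>) * ln z" using assms by (intro mult_le_cancel_left1[THEN iffD2]) auto
    then show "1 + (\<beta> - \<alpha>) \<le> z powr (\<beta> - \<alpha>)"
      using exp_ge_add_one_self[of "(\<beta> - \<alpha>) * ln z"] z3 by (simp add: powr_def del: exp_ge_add_one_self)
  qed (use assms in auto)
  finally have "(1 + \<beta>) * z powr (- \<beta> - 2) \<le> ((1 + \<alpha>) * z powr (\<beta> - \<alpha>)) * z powr (- \<beta> - 2)"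
    by (intro mult_right_mono) auto
  also have "\<dots> = (1 + \<alpha>) * z powr (- \<alpha> - 2)"
    unfolding mult.assoc powr_add[symmetric] by (rule arg_cong[where f = "\<lambda>t. (1 + \<alpha>) * z powr t"]) simp
  finally have "- (1 + \<alpha>) * z powr (- \<alpha> - 2) + (1 + \<beta>) * z powr (- \<beta> - 2) \<le> 0"
    by (simp add: algebra_simps)
  moreover have "((\<lambda>z. z powr (- (1 + \<alpha>)) - z powr (- (1 + \<beta>))) has_real_derivative
       - (1 + \<alpha>) * z powr (- \<alpha> - 2) + (1 + \<beta>) * z powr (- \<beta> - 2)) (at z)"
    using z3 by (auto intro!: derivative_eq_intros simp: algebra_simps)
  ultimately show "\<exists>y. ((\<lambda>z. z powr (- (1 + \<alpha>)) - z powr (- (1 + \<beta>))) has_real_derivative y) (at z) \<and> y \<le> 0"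
    by blast
qed

lemma dseries_diff:
  assumes "0 < \<alpha>" "0 < \<beta>"
  shows "(\<lambda>n. indicator A n * (real n powr (- (1 + \<alpha>)) - real n powr (- (1 + \<beta>)))) sums
           (dseries A (1 + \<alpha>) - dseries A (1 + \<beta>))"
proof -
  have "(\<lambda>n. indicator A n * real n powr (- (1 + \<alpha>)) - indicator A n * real n powr (- (1 + \<beta>))) sums
           (dseries A (1 + \<alpha>) - dseries A (1 + \<beta>))"
    unfolding dseries_def using assms by (intro sums_diff summable_sums summable_dseries) auto
  then show ?thesis by (simp add: right_diff_distrib)
qed

lemma sum_indicator_primes:
  fixes A :: "nat set"
  assumes "A \<subseteq> {p. prime p}"
  shows "(\<Sum>i\<le>n. indicator A i :: real) = real (card (A \<inter> {1..n}))"
proof -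
  have "0 \<notin> A" using assms by (metis mem_Collect_eq not_prime_0 subsetD)
  then have "1 \<le> i" if "i \<in> A" for i using that by (metis One_nat_def Suc_leI gr0I)
  then have "{..n} \<inter> A = A \<inter> {1..n}" by auto
  then show ?thesis by (simp add: indicator_def sum.If_cases)
qed

text \<open>The prime series over all primes diverges as \<open>s\<close> tends to 0. A difference
  of two values has a finite limit and weights that tend to 0 for each fixed \<open>n\<close>, which
  is the setting of \<open>weighted_sum_transfer\<close>.\<close>

lemma dseries_diff_transfer:
  fixes a b \<theta> :: real
  assumes A: "A \<subseteq> {p. prime p}" "has_prime_density A \<theta>" and ab: "0 < a" "a \<le> b"
    and L: "((\<lambda>s. dseries {p. prime p} (1 + a * s) - dseries {p. prime p} (1 + b * s)) \<longlongrightarrow> L) (at_right 0)"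
  shows "((\<lambda>s. dseries A (1 + a * s) - dseries A (1 + b * s)) \<longlongrightarrow> \<theta> * L) (at_right 0)"
proof -
  define w where "w s n = real n powr (- (1 + a * s)) - real n powr (- (1 + b * s))" for s and n :: nat
  have pos: "\<forall>\<^sub>F s::real in at_right 0. s > 0" by (rule eventually_at_right_less)
  have sums: "(\<lambda>n. indicator B n * w s n) sums (dseries B (1 + a * s) - dseries B (1 + b * s))"
    if "s > 0" for s B
    unfolding w_def using that ab by (intro dseries_diff) auto
  have eq: "\<forall>\<^sub>F s in at_right 0. dseries B (1 + a * s) - dseries B (1 + b * s) = (\<Sum>n. indicator B n * w s n)" for B
    using pos by eventually_elim (rule sums_unique[OF sums])
  have "((\<lambda>s. \<Sum>n. indicator A n * w s n) \<longlongrightarrow> \<theta> * L) (at_right 0)"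
  proof (rule weighted_sum_transfer[where k = 3 and b = "indicator {p. prime p}"])
    show "(\<lambda>n. (\<Sum>i\<le>n. indicator A i) / (\<Sum>i\<le>n. indicator {p. prime p} i)) \<longlonglongrightarrow> \<theta>"
      using A by (simp add: sum_indicator_primes has_prime_density_def)
    show "\<forall>\<^sub>F n in sequentially. (\<Sum>i\<le>n. indicator {p. prime p} i :: real) > 0"
      using eventually_ge_at_top[of 2]
    proof eventually_elim
      case (elim n)
      then have "2 \<in> {p. prime p} \<inter> {1..n}" by (auto simp: two_is_prime_nat)
      then have "{p. prime p} \<inter> {1..n} \<noteq> {}" by blast
      then show ?case by (subst sum_indicator_primes) (simp_all add: card_gt_0_iff)
    qed
    show "\<forall>\<^sub>F s in at_right 0. (\<forall>n. 0 \<le> w s n) \<and> (\<forall>n\<ge>3. w s (Suc n) \<le> w s n) \<and>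
         summable (\<lambda>n. indicator A n * w s n) \<and> summable (\<lambda>n. indicator {p. prime p} n * w s n)"
      using pos
    proof eventually_elim
      case (elim s)
      have le: "a * s \<le> b * s" using ab elim by simp
      have "real n powr (- (1 + b * s)) \<le> real n powr (- (1 + a * s))" for n
        using le by (cases "n = 0") (auto intro!: powr_mono)
      moreover have "w s (Suc n) \<le> w s n" if "n \<ge> 3" for n
        unfolding w_def by (rule powr_diff_antimono) (use that ab elim le in auto)
      ultimately show ?case using sums[OF elim] by (auto simp: w_def summable_def)
    qed
    show "((\<lambda>s. w s n) \<longlongrightarrow> 0) (at_right 0)" for n
    proof (cases "n = 0")
      case False
      then have "((\<lambda>s. w s n) \<longlongrightarrow> real n powr (- (1 + a * 0)) - real n powr (- (1 + b * 0))) (at_right 0)"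
        unfolding w_def by (intro tendsto_intros) auto
      then show ?thesis by simp
    qed (simp add: w_def)
    show "((\<lambda>s. \<Sum>n. indicator {p. prime p} n * w s n) \<longlongrightarrow> L) (at_right 0)"
      using Lim_transform_eventually[OF L eq] .
  qed
  with eq show ?thesis by (subst tendsto_cong)
qed

subsection \<open>Euler products\<close>

text \<open>\<open>E\<close> is the set of exponents allowed: \<open>UNIV\<close> yields
  \<open>integers_over A\<close> and \<open>{..<k}\<close> its \<open>k\<close>-free members, so
  that both limits follow from one argument.\<close>

definition exponent_set :: "nat set \<Rightarrow> nat set \<Rightarrow> nat set" where
  "exponent_set A E = {n. n > 0 \<and> (\<forall>p. prime p \<longrightarrow> multiplicity p n \<in> (if p \<in> A then E else {0}))}"

text \<open>The Euler factor of a prime \<open>p\<close> at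
  \<open>y = real p powr (- \<sigma>)\<close>. For \<open>0 \<le> y < 1\<close> it is
  \<open>1 / (1 - y)\<close> if \<open>E = UNIV\<close> and \<open>1 + y + ... + y ^ (k - 1)\<close>
  if \<open>E = {..<k}\<close>.\<close>

definition local_factor :: "nat set \<Rightarrow> real \<Rightarrow> real" where
  "local_factor E y = (\<Sum>j. indicator E j * y ^ j)"

lemma summable_local_factor:
  assumes "0 \<le> y" "y < 1"
  shows "summable (\<lambda>j. indicator E j * y ^ j :: real)"
proof (rule summable_comparison_test)
  show "summable (\<lambda>j. y ^ j)" using assms by simp
qed (use assms in \<open>auto simp: indicator_def\<close>)

lemma has_sum_indicator_sums:
  fixes f :: "nat \<Rightarrow> real"
  assumes "\<And>n. n \<in> A \<Longrightarrow> f n \<ge> 0"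
  shows "(f has_sum S) A \<longleftrightarrow> (\<lambda>n. indicator A n * f n) sums S"
proof -
  have "(f has_sum S) A \<longleftrightarrow> ((\<lambda>n. indicator A n * f n) has_sum S) UNIV"
    by (intro has_sum_cong_neutral) auto
  also have "\<dots> \<longleftrightarrow> (\<lambda>n. indicator A n * f n) sums S"
  proof
    assume "(\<lambda>n. indicator A n * f n) sums S"
    then show "((\<lambda>n. indicator A n * f n) has_sum S) UNIV"
      by (rule sums_nonneg_imp_has_sum) (use assms in \<open>auto simp: indicator_def\<close>)
  qed (rule has_sum_imp_sums)
  finally show ?thesis .
qed

lemma has_sum_local_factor:
  assumes "0 \<le> y" "y < 1"
  shows "((\<lambda>j. y ^ j) has_sum local_factor E y) E"
  using assms summable_sums[OF summable_local_factor[OF assms]]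
  by (subst has_sum_indicator_sums) (auto simp: local_factor_def)

lemma local_factor_bounds:
  assumes "{0, 1} \<subseteq> E" "0 \<le> y" "y < 1"
  shows "1 + y \<le> local_factor E y" "local_factor E y \<le> 1 / (1 - y)"
proof -
  have "(\<Sum>j\<in>{0, 1}. indicator E j * y ^ j) \<le> (\<Sum>j. indicator E j * y ^ j)"
    using assms by (intro sum_le_suminf summable_local_factor) auto
  also have "(\<Sum>j\<in>{0, 1}. indicator E j * y ^ j) = (\<Sum>j\<in>{0, 1}. y ^ j)"
    using assms by (intro sum.cong) auto
  finally show "1 + y \<le> local_factor E y" by (simp add: local_factor_def)
  have "(\<Sum>j. indicator E j * y ^ j) \<le> (\<Sum>j. y ^ j)"
    using assms by (intro suminf_le summable_local_factor) (auto simp: indicator_def)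
  also have "\<dots> = 1 / (1 - y)" using assms by (intro suminf_geometric) auto
  finally show "local_factor E y \<le> 1 / (1 - y)" by (simp add: local_factor_def)
qed

text \<open>The exponents 0 and 1 make the factor at least \<open>1 + y\<close>, and admitting all
  exponents bounds it by \<open>1 / (1 - y)\<close>. Both logarithms are \<open>y\<close> up to
  \<open>2 * y\<^sup>2\<close>, so the first-order term is the same for every such
  \<open>E\<close>.\<close>

lemma ln_local_factor_bound:
  assumes "{0, 1} \<subseteq> E" "0 \<le> y" "y \<le> 1 / 2"
  shows "\<bar>ln (local_factor E y) - y\<bar> \<le> 2 * y\<^sup>2"
proof -
  have b: "1 + y \<le> local_factor E y" "local_factor E y \<le> 1 / (1 - y)"
    using local_factor_bounds[of E y] assms by auto
  have "ln (1 + y) \<le> ln (local_factor E y)" using b assms by (intro ln_mono) auto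
  moreover have "ln (local_factor E y) \<le> ln (1 / (1 - y))" using b assms by (intro ln_mono) auto
  moreover have "ln (1 / (1 - y)) = - ln (1 + (- y))" using assms by (simp add: ln_div)
  ultimately show ?thesis
    using abs_ln_one_plus_x_minus_x_bound[of y] abs_ln_one_plus_x_minus_x_bound[of "- y"] assms
    by (simp add: abs_le_iff)
qed

lemma isCont_ln_local_factor:
  assumes "{0, 1} \<subseteq> E" "0 \<le> y" "y < 1"
  shows "isCont (\<lambda>y. ln (local_factor E y)) y"
proof -
  have "isCont (local_factor E) y" unfolding local_factor_def[abs_def]
    using assms by (intro isCont_powser[where K = "(1 + y) / 2"] summable_local_factor) auto
  moreover have "local_factor E y \<noteq> 0" using local_factor_bounds(1)[OF assms] assms by auto
  ultimately show ?thesis by (intro isCont_ln') auto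
qed

section \<open>Unordered Euler products, first over finitely many primes and then over all of
  \<open>A\<close>\<close>

lemma exponent_set_empty: "exponent_set {} E = {1}"
proof -
  have "n = 1" if "n > 0" "\<forall>p. prime p \<longrightarrow> multiplicity p n = 0" for n :: nat
  proof (rule ccontr)
    assume "n \<noteq> 1"
    then obtain p where p: "prime p" "p dvd n" using prime_factor_nat by blast
    then have "multiplicity p n > 0" using that(1) by (simp add: prime_multiplicity_gt_zero_iff)
    with that(2) p(1) show False by simp
  qed
  then show ?thesis by (auto simp: exponent_set_def)
qed

text \<open>A prime \<open>p\<close> outside \<open>A\<close> divides no member of
  \<open>exponent_set A E\<close>, so the power of \<open>p\<close> can be split off uniquely. This
  is the induction step of the Euler product.\<close>

lemma bij_betw_exponent_set_insert:
  assumes p: "prime p" "p \<notin> A"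
  shows "bij_betw (\<lambda>(j, m). p ^ j * m) (E \<times> exponent_set A E) (exponent_set (insert p A) E)"
proof -
  have p0: "p > 0" "\<not> is_unit p" using p by (auto simp: prime_gt_0_nat)
  have mult: "multiplicity q (p ^ j * m) = (if q = p then j + multiplicity p m else multiplicity q m)"
    if "m > 0" "prime q" for q j m
    using that p p0 by (auto simp: prime_elem_multiplicity_mult_distrib
        prime_elem_multiplicity_power_distrib prime_multiplicity_other)
  show ?thesis
  proof (rule bij_betw_byWitness[where f' = "\<lambda>n. (multiplicity p n, n div p ^ multiplicity p n)"])
    have m0: "multiplicity p m = 0" if "m \<in> exponent_set A E" for m
      using that p by (auto simp: exponent_set_def)
    show "\<forall>a\<in>E \<times> exponent_set A E.
       (multiplicity p (case a of (j, m) \<Rightarrow> p ^ j * m),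
        (case a of (j, m) \<Rightarrow> p ^ j * m) div p ^ multiplicity p (case a of (j, m) \<Rightarrow> p ^ j * m)) = a"
      using p p0 m0 by (auto simp: mult exponent_set_def)
    show "\<forall>n\<in>exponent_set (insert p A) E.
       (case (multiplicity p n, n div p ^ multiplicity p n) of (j, m) \<Rightarrow> p ^ j * m) = n"
      by (auto simp: multiplicity_dvd)
    show "(\<lambda>(j, m). p ^ j * m) ` (E \<times> exponent_set A E) \<subseteq> exponent_set (insert p A) E"
      using p0 m0 by (auto simp: exponent_set_def mult p split: if_splits)
    show "(\<lambda>n. (multiplicity p n, n div p ^ multiplicity p n)) ` exponent_set (insert p A) E
        \<subseteq> E \<times> exponent_set A E"
    proof clarify
      fix n assume n: "n \<in> exponent_set (insert p A) E"
      then have n0: "n > 0" by (simp add: exponent_set_def)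
      then obtain m where m: "n = p ^ multiplicity p n * m" "\<not> p dvd m"
        using multiplicity_decompose'[of n p] p0 by auto
      define j where "j = multiplicity p n"
      have nj: "n = p ^ j * m" using m by (simp add: j_def)
      then have mpos: "m > 0" using n0 by (cases m) auto
      have jE: "j \<in> E" using n p by (auto simp: exponent_set_def j_def)
      have "multiplicity q m \<in> (if q \<in> A then E else {0})" if "prime q" for q
      proof (cases "q = p")
        case True
        then show ?thesis using p m(2) by (simp add: not_dvd_imp_multiplicity_0)
      next
        case False
        then have "multiplicity q m = multiplicity q n" using mult[OF mpos that, of j] nj by simp
        then show ?thesis using n that False by (auto simp: exponent_set_def)
      qed
      then have "m \<in> exponent_set A E" using mpos by (simp add: exponent_set_def)
      moreover have "n div p ^ j = m" using nj p0 by simp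
      ultimately show "multiplicity p n \<in> E \<and> n div p ^ multiplicity p n \<in> exponent_set A E"
        using jE by (simp add: j_def)
    qed
  qed
qed

text \<open>Finitely many primes give convergence for every \<open>\<sigma> > 0\<close>; the
  numerators of the theorem are the case \<open>\<sigma> = 1\<close>. The induction turns a sum over
  pairs into a product of sums.\<close>

lemma has_sum_exponent_set_finite:
  assumes "finite A" "A \<subseteq> {p. prime p}" "\<sigma> > 0"
  shows "((\<lambda>n. real n powr (- \<sigma>)) has_sum (\<Prod>p\<in>A. local_factor E (real p powr (- \<sigma>)))) (exponent_set A E)"
  using assms(1,2)
proof (induction A rule: finite_induct)
  case empty
  then show ?case by (simp add: exponent_set_empty has_sum_finite_iff)
next
  case (insert p A)
  define y where "y = real p powr (- \<sigma>)"
  have p: "prime p" using insert by auto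
  then have "real p > 1" using prime_gt_1_nat by simp
  then have y: "0 \<le> y" "y < 1" using assms(3) by (auto simp: y_def powr_less_one)
  define P where "P = (\<Prod>p\<in>A. local_factor E (real p powr (- \<sigma>)))"
  have IH: "((\<lambda>n. real n powr (- \<sigma>)) has_sum P) (exponent_set A E)"
    using insert by (simp add: P_def)
  have rows: "((\<lambda>m. (case (j, m) of (j, m) \<Rightarrow> y ^ j * real m powr (- \<sigma>))) has_sum y ^ j * P) (exponent_set A E)" for j
    using has_sum_cmult_right[OF IH] by simp
  have tot: "((\<lambda>j. y ^ j * P) has_sum local_factor E y * P) E"
    by (intro has_sum_cmult_left has_sum_local_factor y)
  have "((\<lambda>(j, m). y ^ j * real m powr (- \<sigma>)) has_sum local_factor E y * P) (E \<times> exponent_set A E)"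
    by (rule has_sum_SigmaI[OF rows tot summable_on_SigmaI[OF rows has_sum_imp_summable[OF tot]]])
       (use y in auto)
  also have "?this \<longleftrightarrow> ((\<lambda>x. (\<lambda>n. real n powr (- \<sigma>)) ((\<lambda>(j, m). p ^ j * m) x)) has_sum local_factor E y * P)
      (E \<times> exponent_set A E)"
  proof (intro has_sum_cong)
    fix x assume "x \<in> E \<times> exponent_set A E"
    obtain j m where x: "x = (j, m)" by (cases x)
    have "(real p ^ j) powr (- \<sigma>) = (real p powr real j) powr (- \<sigma>)"
      using \<open>real p > 1\<close> by (subst powr_realpow) auto
    also have "\<dots> = real p powr (real j * - \<sigma>)" by (rule powr_powr)
    also have "\<dots> = y ^ j" using \<open>real p > 1\<close> unfolding y_def by (subst powr_power) auto
    finally have "(real p ^ j) powr (- \<sigma>) = y ^ j" .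
    then show "(case x of (j, m) \<Rightarrow> y ^ j * real m powr - \<sigma>) =
        real (case x of (j, m) \<Rightarrow> p ^ j * m) powr - \<sigma>"
      by (simp add: x powr_mult)
  qed
  also have "\<dots> \<longleftrightarrow> ((\<lambda>n. real n powr (- \<sigma>)) has_sum local_factor E y * P) (exponent_set (insert p A) E)"
    by (rule has_sum_reindex_bij_betw, rule bij_betw_exponent_set_insert) (use p insert in auto)
  finally show ?case using insert by (simp add: P_def y_def)
qed

lemma exponent_set_mono:
  assumes "0 \<in> E" "A \<subseteq> B"
  shows "exponent_set A E \<subseteq> exponent_set B E"
proof -
  have "(if p \<in> A then E else {0}) \<subseteq> (if p \<in> B then E else {0})" for p
    using assms by auto
  then show ?thesis unfolding exponent_set_def by blast
qed

lemma exponent_set_le: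
  assumes "n \<in> exponent_set A E" "n \<le> N" "0 \<in> E"
  shows "n \<in> exponent_set {p \<in> A. p \<le> N} E"
  unfolding exponent_set_def
proof (intro CollectI conjI allI impI)
  show n0: "n > 0" using assms by (simp add: exponent_set_def)
  fix p :: nat assume p: "prime p"
  show "multiplicity p n \<in> (if p \<in> {p \<in> A. p \<le> N} then E else {0})"
  proof (cases "p \<le> N")
    case True
    then show ?thesis using assms p by (auto simp: exponent_set_def)
  next
    case False
    then have "\<not> p dvd n" using assms n0 by (meson dvd_imp_le le_trans)
    then show ?thesis using assms False by (simp add: not_dvd_imp_multiplicity_0)
  qed
qed

lemma one_in_exponent_set: "0 \<in> E \<Longrightarrow> 1 \<in> exponent_set A E"
  by (auto simp: exponent_set_def)

lemma sum_over_primes_le: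
  fixes f :: "nat \<Rightarrow> real"
  shows "(\<Sum>p\<in>{p \<in> A. p \<le> N}. f p) = (\<Sum>p\<le>N. indicator A p * f p)"
proof -
  have "(\<Sum>p\<le>N. indicator A p * f p) = (\<Sum>p\<le>N. if p \<in> A then f p else 0)"
    by (intro sum.cong) auto
  also have "\<dots> = (\<Sum>p\<in>{p \<in> {..N}. p \<in> A}. f p)" by (rule sum.inter_filter[symmetric]) simp
  finally show ?thesis by (simp add: conj_commute)
qed

lemma dseries_exponent_set_ge_1:
  assumes "0 \<in> E" "\<sigma> > 1"
  shows "dseries (exponent_set A E) \<sigma> \<ge> 1"
proof -
  have "(\<Sum>n\<in>{1}. indicator (exponent_set A E) n * real n powr (- \<sigma>)) \<le> dseries (exponent_set A E) \<sigma>"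
    unfolding dseries_def using assms by (intro sum_le_suminf summable_dseries) auto
  then show ?thesis using one_in_exponent_set[OF assms(1), of A] by simp
qed

text \<open>The product over \<open>p \<le> N\<close> is the sum over those members whose prime
  divisors are at most \<open>N\<close>. It lies between the partial sum up to \<open>N\<close> and
  the whole series, which squeezes it to the Dirichlet series before logarithms are taken.\<close>

lemma ln_dseries_exponent_set:
  assumes E: "{0, 1} \<subseteq> E" and A: "A \<subseteq> {p. prime p}" and \<sigma>: "\<sigma> > 1"
  shows "(\<lambda>p. indicator A p * ln (local_factor E (real p powr (- \<sigma>)))) sums
           ln (dseries (exponent_set A E) \<sigma>)"
proof -
  define S where "S N = (\<Prod>p\<in>{p \<in> A. p \<le> N}. local_factor E (real p powr (- \<sigma>)))" for N
  let ?f = "\<lambda>n. real n powr (- \<sigma>)"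
  have hs: "(?f has_sum S N) (exponent_set {p \<in> A. p \<le> N} E)" for N
    unfolding S_def using A \<sigma> by (intro has_sum_exponent_set_finite) auto
  have lim: "(\<lambda>n. indicator (exponent_set A E) n * ?f n) sums dseries (exponent_set A E) \<sigma>"
    unfolding dseries_def by (intro summable_sums summable_dseries \<sigma>)
  then have hsA: "(?f has_sum dseries (exponent_set A E) \<sigma>) (exponent_set A E)"
    by (subst has_sum_indicator_sums) auto
  have "S \<longlonglongrightarrow> dseries (exponent_set A E) \<sigma>"
  proof (rule tendsto_sandwich)
    show "\<forall>\<^sub>F N in sequentially. (\<Sum>n\<le>N. indicator (exponent_set A E) n * ?f n) \<le> S N"
    proof (intro always_eventually allI)
      fix N
      show "(\<Sum>n\<le>N. indicator (exponent_set A E) n * ?f n) \<le> S N"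
        unfolding sum_over_primes_le[symmetric]
        by (rule finite_sum_le_has_sum[OF hs]) (use E exponent_set_le in auto)
    qed
    show "\<forall>\<^sub>F N in sequentially. S N \<le> dseries (exponent_set A E) \<sigma>"
      using E by (intro always_eventually allI has_sum_mono2[OF hs hsA] exponent_set_mono) auto
    show "(\<lambda>N. \<Sum>n\<le>N. indicator (exponent_set A E) n * ?f n) \<longlonglongrightarrow> dseries (exponent_set A E) \<sigma>"
      using lim by (simp add: sums_def_le)
  qed simp
  then have "(\<lambda>N. ln (S N)) \<longlonglongrightarrow> ln (dseries (exponent_set A E) \<sigma>)"
    using dseries_exponent_set_ge_1[of E \<sigma> A] E \<sigma> by (intro tendsto_ln) auto
  moreover have "ln (S N) = (\<Sum>p\<le>N. indicator A p * ln (local_factor E (real p powr (- \<sigma>))))" for N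
  proof -
    have pos: "0 < local_factor E (real p powr (- \<sigma>))" if "p \<in> A" for p
    proof -
      have "real p > 1" using that A prime_gt_1_nat by auto
      then have "real p powr (- \<sigma>) < 1" using \<sigma> by (simp add: powr_less_one)
      then show ?thesis using local_factor_bounds(1)[OF E, of "real p powr (- \<sigma>)"]
        by (smt (verit) powr_ge_zero)
    qed
    have "ln (S N) = (\<Sum>p\<in>{p \<in> A. p \<le> N}. ln (local_factor E (real p powr (- \<sigma>))))"
      unfolding S_def by (intro ln_prod) (auto dest: pos)
    then show ?thesis by (simp add: sum_over_primes_le)
  qed
  ultimately show ?thesis by (simp add: sums_def_le)
qed

section \<open>The continuous part of the logarithm of the Euler product\<close>

definition euler_remainder :: "nat set \<Rightarrow> nat set \<Rightarrow> real \<Rightarrow> real" where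
  "euler_remainder A E s = (\<Sum>p. indicator A p *
     (ln (local_factor E (real p powr (- (1 + s)))) - real p powr (- (1 + s))))"

text \<open>Since \<open>real p powr (- (1 + s))\<close> is at most \<open>1 / real p\<close>, hence
  at most 1/2, the second-order bound for the Euler factors applies uniformly in
  \<open>s \<ge> 0\<close>. So \<open>euler_remainder\<close> makes sense at \<open>s = 0\<close> as
  well.\<close>

lemma euler_remainder_term_bound:
  assumes "{0, 1} \<subseteq> E" "A \<subseteq> {p. prime p}" "s \<ge> 0"
  shows "\<bar>indicator A p * (ln (local_factor E (real p powr (- (1 + s)))) - real p powr (- (1 + s)))\<bar>
           \<le> 2 * real p powr (- 2)"
proof (cases "p \<in> A")
  case True
  then have p: "real p \<ge> 2" using assms(2) prime_ge_2_nat by auto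
  define y where "y = real p powr (- (1 + s))"
  have "y \<le> real p powr (- 1)" unfolding y_def using p assms(3) by (intro powr_mono) auto
  then have y: "y \<le> 1 / real p" using p by (simp add: powr_minus_divide)
  also have "\<dots> \<le> 1 / 2" using p by (simp add: field_simps)
  finally have "\<bar>ln (local_factor E y) - y\<bar> \<le> 2 * y\<^sup>2"
    using assms by (intro ln_local_factor_bound) (auto simp: y_def)
  also have "y\<^sup>2 \<le> (1 / real p)\<^sup>2" using y by (intro power_mono) (auto simp: y_def)
  also have "\<dots> = real p powr (- 2)" using p by (simp add: powr_minus power_one_over inverse_eq_divide)
  finally show ?thesis using True by (simp add: y_def)
qed auto

lemma euler_remainder_sums:
  assumes "{0, 1} \<subseteq> E" "A \<subseteq> {p. prime p}" "s \<ge> 0"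
  shows "(\<lambda>p. indicator A p * (ln (local_factor E (real p powr (- (1 + s)))) - real p powr (- (1 + s))))
           sums euler_remainder A E s"
  unfolding euler_remainder_def
proof (intro summable_sums, rule summable_comparison_test)
  show "summable (\<lambda>p. 2 * real p powr (- 2))"
    by (intro summable_mult) (simp add: summable_real_powr_iff)
qed (use euler_remainder_term_bound[OF assms] in auto)

lemma ln_dseries_eq:
  assumes "{0, 1} \<subseteq> E" "A \<subseteq> {p. prime p}" "s > 0"
  shows "ln (dseries (exponent_set A E) (1 + s)) = dseries A (1 + s) + euler_remainder A E s"
proof -
  have "(\<lambda>p. indicator A p * real p powr (- (1 + s)) +
      indicator A p * (ln (local_factor E (real p powr (- (1 + s)))) - real p powr (- (1 + s))))
      sums (dseries A (1 + s) + euler_remainder A E s)"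
    using assms unfolding dseries_def
    by (intro sums_add summable_sums summable_dseries euler_remainder_sums) auto
  moreover have "(\<lambda>p. indicator A p * ln (local_factor E (real p powr (- (1 + s)))))
      sums ln (dseries (exponent_set A E) (1 + s))"
    using assms by (intro ln_dseries_exponent_set) auto
  ultimately show ?thesis by (auto simp: algebra_simps intro: sums_unique2)
qed

text \<open>Tannery's theorem with the majorant \<open>2 * real p powr (- 2)\<close>. Each term is
  continuous at \<open>s = 0\<close> because the Euler factor is a power series taken at an argument
  below 1.\<close>

lemma tendsto_euler_remainder:
  assumes "{0, 1} \<subseteq> E" "A \<subseteq> {p. prime p}"
  shows "(euler_remainder A E \<longlongrightarrow> euler_remainder A E 0) (at_right 0)"
  unfolding euler_remainder_def[abs_def]
proof (rule tannerys_theorem[THEN conjunct2, THEN conjunct2])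
  fix p :: nat
  show "((\<lambda>s. indicator A p * (ln (local_factor E (real p powr (- (1 + s)))) - real p powr (- (1 + s))))
     \<longlongrightarrow> indicator A p * (ln (local_factor E (real p powr (- (1 + 0)))) - real p powr (- (1 + 0)))) (at_right 0)"
  proof (cases "p \<in> A")
    case True
    then have p: "real p \<ge> 2" using assms(2) prime_ge_2_nat by auto
    have "((\<lambda>s. real p powr (- (1 + s))) \<longlongrightarrow> real p powr (- (1 + 0))) (at_right 0)"
      using p by (intro tendsto_intros) auto
    moreover have "isCont (\<lambda>y. ln (local_factor E y)) (real p powr (- (1 + 0)))"
      using p by (intro isCont_ln_local_factor assms powr_less_one) auto
    ultimately show ?thesis
      by (intro tendsto_mult tendsto_const tendsto_diff
          isCont_tendsto_compose[of _ "\<lambda>y. ln (local_factor E y)"])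
  qed auto
next
  show "summable (\<lambda>p. 2 * real p powr (- 2))"
    by (intro summable_mult) (simp add: summable_real_powr_iff)
  have "\<forall>\<^sub>F x in sequentially \<times>\<^sub>F at_right (0::real). snd x > 0"
    by (rule eventually_compose_filterlim[OF eventually_at_right_less filterlim_snd])
  then show "\<forall>\<^sub>F (p, s) in sequentially \<times>\<^sub>F at_right 0.
     norm (indicator A p * (ln (local_factor E (real p powr (- (1 + s)))) - real p powr (- (1 + s))))
       \<le> 2 * real p powr (- 2)"
    by eventually_elim (use euler_remainder_term_bound[OF assms] in auto)
qed auto

subsection \<open>Asymptotics of products and partial sums\<close>

lemma filterlim_cmult_at_right_0:
  assumes "a > (0::real)"
  shows "filterlim (\<lambda>s. a * s) (at_right 0) (at_right 0)"
  unfolding filterlim_at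
proof
  have "((\<lambda>s. a * s) \<longlongrightarrow> a * 0) (at_right 0)" by (intro tendsto_intros)
  then show "((\<lambda>s. a * s) \<longlongrightarrow> 0) (at_right 0)" by simp
  show "\<forall>\<^sub>F s in at_right 0. a * s \<in> {0<..} \<and> a * s \<noteq> 0"
    using eventually_at_right_less[of 0] by eventually_elim (use assms in auto)
qed

lemma exponent_set_primes_UNIV: "exponent_set {p. prime p} UNIV = {1..}"
  by (auto simp: exponent_set_def)

text \<open>Both remainders tend to \<open>euler_remainder A E 0\<close> and cancel, so in
  differences the logarithms may be replaced by prime sums.\<close>

lemma dseries_ln_diff:
  assumes "{0, 1} \<subseteq> E" "A \<subseteq> {p. prime p}" "a > 0" "b > 0"
  shows "((\<lambda>s. (ln (dseries (exponent_set A E) (1 + a * s)) - ln (dseries (exponent_set A E) (1 + b * s))) -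
     (dseries A (1 + a * s) - dseries A (1 + b * s))) \<longlongrightarrow> 0) (at_right 0)"
proof -
  have "((\<lambda>s. euler_remainder A E (c * s)) \<longlongrightarrow> euler_remainder A E 0) (at_right 0)" if "c > 0" for c
    by (rule filterlim_compose[OF tendsto_euler_remainder filterlim_cmult_at_right_0[OF that]])
       (use assms in auto)
  from tendsto_diff[OF this[OF assms(3)] this[OF assms(4)]]
  have "((\<lambda>s. euler_remainder A E (a * s) - euler_remainder A E (b * s)) \<longlongrightarrow> 0) (at_right 0)"
    by simp
  moreover have "\<forall>\<^sub>F s in at_right 0. euler_remainder A E (a * s) - euler_remainder A E (b * s) =
     (ln (dseries (exponent_set A E) (1 + a * s)) - ln (dseries (exponent_set A E) (1 + b * s))) -
     (dseries A (1 + a * s) - dseries A (1 + b * s))"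
    using eventually_at_right_less[of 0]
    by eventually_elim (use assms in \<open>simp add: ln_dseries_eq\<close>)
  ultimately show ?thesis by (rule Lim_transform_eventually)
qed

lemma dseries_primes_diff:
  assumes "0 < a" "a \<le> b"
  shows "((\<lambda>s. dseries {p. prime p} (1 + a * s) - dseries {p. prime p} (1 + b * s))
           \<longlongrightarrow> ln (b / a)) (at_right 0)"
proof -
  let ?Z = "\<lambda>s. dseries {1..} (1 + s)"
  have lim: "((\<lambda>s. ln (c * s * ?Z (c * s))) \<longlongrightarrow> 0) (at_right 0)" if "c > 0" for c
  proof -
    have "((\<lambda>s. ln (c * s * ?Z (c * s))) \<longlongrightarrow> ln 1) (at_right 0)"
      by (intro tendsto_ln filterlim_compose[OF dseries_zeta_asymp filterlim_cmult_at_right_0] that) auto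
    then show ?thesis by simp
  qed
  have Z1: "?Z (c * s) \<ge> 1" if "c > 0" "s > 0" for c s
    using dseries_exponent_set_ge_1[of UNIV "1 + c * s" "{p. prime p}"] that
    by (simp add: exponent_set_primes_UNIV)
  have "((\<lambda>s. ln (a * s * ?Z (a * s)) - ln (b * s * ?Z (b * s)) + ln (b / a)) \<longlongrightarrow> 0 - 0 + ln (b / a)) (at_right 0)"
    using assms by (intro tendsto_intros lim) auto
  moreover have "\<forall>\<^sub>F s in at_right 0. ln (a * s * ?Z (a * s)) - ln (b * s * ?Z (b * s)) + ln (b / a) =
      ln (?Z (a * s)) - ln (?Z (b * s))"
    using eventually_at_right_less[of 0]
  proof eventually_elim
    case (elim s)
    then show ?case using assms Z1[of a s] Z1[of b s] by (simp add: ln_mult ln_div)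
  qed
  ultimately have 1: "((\<lambda>s. ln (?Z (a * s)) - ln (?Z (b * s))) \<longlongrightarrow> 0 - 0 + ln (b / a)) (at_right 0)"
    by (rule Lim_transform_eventually)
  have 2: "((\<lambda>s. (ln (?Z (a * s)) - ln (?Z (b * s))) -
     (dseries {p. prime p} (1 + a * s) - dseries {p. prime p} (1 + b * s))) \<longlongrightarrow> 0) (at_right 0)"
    using dseries_ln_diff[of UNIV "{p. prime p}" a b] assms by (simp add: exponent_set_primes_UNIV)
  from tendsto_diff[OF 1 2] show ?thesis by simp
qed

lemma dseries_density_diff:
  assumes "A \<subseteq> {p. prime p}" "has_prime_density A \<theta>" "0 < a" "a \<le> b"
  shows "((\<lambda>s. dseries A (1 + a * s) - dseries A (1 + b * s)) \<longlongrightarrow> \<theta> * ln (b / a)) (at_right 0)"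
  by (intro dseries_diff_transfer assms dseries_primes_diff)

text \<open>The mass \<open>w s n\<close> sits at \<open>real n powr (- s)\<close>, that is at
  \<open>exp (- u)\<close> with \<open>u = s * ln n\<close>. In the variable \<open>u\<close> the
  limit measure has density \<rho> on the positive half-line. For \<open>s = 1 / ln N\<close> the
  threshold \<open>exp (- 1)\<close> separates \<open>n > N\<close> from
  \<open>n \<le> N\<close>.\<close>

lemma discrete_weighted_limit:
  fixes w :: "real \<Rightarrow> nat \<Rightarrow> real" and \<rho> :: "real \<Rightarrow> real"
  assumes w: "\<And>s. s > 0 \<Longrightarrow> (\<forall>n. w s n \<ge> 0) \<and> w s 0 = 0 \<and> summable (w s)"
    and [measurable]: "\<rho> \<in> borel_measurable borel" and rho: "\<And>u. u > 0 \<Longrightarrow> \<rho> u \<ge> 0"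
    and mu: "\<And>j. has_bochner_integral lborel
               (\<lambda>u. indicator {0<..} u * (\<rho> u * exp (- (real j * u)))) (\<mu> j)"
    and mom: "\<And>j. ((\<lambda>s. \<Sum>n. w s n * real n powr (- (real j * s))) \<longlongrightarrow> \<mu> j) (at_right 0)"
    and g: "continuous_on UNIV g1" "continuous_on UNIV g2"
    and J: "has_bochner_integral lborel (\<lambda>u. indicator {0<..} u *
              (\<rho> u * (if u > 1 then g1 (exp (- u)) else g2 (exp (- u))))) J"
  shows "((\<lambda>s. \<Sum>n. w s n * (if real n powr (- s) < exp (- 1) then g1 (real n powr (- s))
             else g2 (real n powr (- s)))) \<longlongrightarrow> J) (at_right 0)"
proof -
  define e where "e u = indicator {0<..} u * \<rho> u" for u
  \<comment> \<open>The clamp at 0, and the value 0 of \<open>X\<close> for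
    \<open>s \<le> 0\<close>, keep both maps in the unit interval everywhere, as
    \<open>weighted_unit\<close> demands.\<close>
  define Y where "Y u = exp (- max 0 u)" for u :: real
  define X where "X s n = (if s > 0 then real n powr (- s) else 0)" for s and n :: nat
  have pos: "\<forall>\<^sub>F s::real in at_right 0. s > 0" by (rule eventually_at_right_less)
  have X: "X s n \<in> {0..1}" for s n
  proof (cases "n = 0 \<or> s \<le> 0")
    case False
    then have "real n powr (- s) \<le> real n powr 0" by (intro powr_mono) auto
    with False show ?thesis by (simp add: X_def)
  qed (auto simp: X_def)
  have ev: "weighted_unit (count_space UNIV) (w s) (X s)" if "s > 0" for s
    using w[OF that] X unfolding weighted_unit_def by (simp add: integrable_count_space_nat_iff)
  have "e = (\<lambda>u. indicator {0<..} u * (\<rho> u * exp (- (real 0 * u))))" by (simp add: e_def fun_eq_iff)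
  then have "integrable lborel e" using mu[of 0] by (simp add: has_bochner_integral_iff)
  moreover have "Y \<in> borel_measurable borel" unfolding Y_def by measurable
  ultimately have lim: "weighted_unit lborel e Y"
    using rho by (auto simp: weighted_unit_def Y_def e_def indicator_def)
  have int: "(\<integral>n. w s n * f (X s n) \<partial>count_space UNIV) = (\<Sum>n. w s n * f (real n powr (- s)))"
    if "s > 0" "f \<in> borel_measurable borel" "\<And>t. t \<in> {0..1} \<Longrightarrow> \<bar>f t\<bar> \<le> B" for s B and f :: "real \<Rightarrow> real"
    using that weighted_unit_integrable[OF ev[OF that(1)] that(2,3)]
    by (subst integral_count_space_nat) (auto simp: X_def)
  obtain B1 where B1: "B1 \<ge> 0" "\<And>t. t \<in> {0..1} \<Longrightarrow> \<bar>g1 t\<bar> \<le> B1"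
    using continuous_bounded_on_unit[OF g(1)] by auto
  obtain B2 where B2: "B2 \<ge> 0" "\<And>t. t \<in> {0..1} \<Longrightarrow> \<bar>g2 t\<bar> \<le> B2"
    using continuous_bounded_on_unit[OF g(2)] by auto
  have [measurable]: "g1 \<in> borel_measurable borel" "g2 \<in> borel_measurable borel"
    using g by (auto intro: borel_measurable_continuous_onI)
  have "((\<lambda>s. \<integral>n. w s n * (if X s n < exp (- 1) then g1 (X s n) else g2 (X s n)) \<partial>count_space UNIV)
           \<longlongrightarrow> (\<integral>u. e u * (if Y u < exp (- 1) then g1 (Y u) else g2 (Y u)) \<partial>lborel)) (at_right 0)"
  proof (rule weighted_limit_piecewise[OF _ lim _ g])
    show "\<forall>\<^sub>F s in at_right 0. weighted_unit (count_space UNIV) (w s) (X s)"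
      using pos by eventually_elim (rule ev)
    show "AE u in lborel. Y u \<noteq> exp (- 1)"
      using AE_lborel_singleton[of 1] by eventually_elim (auto simp: Y_def max_def)
    fix j
    have "(\<integral>u. e u * Y u ^ j \<partial>lborel) = (\<integral>u. indicator {0<..} u * (\<rho> u * exp (- (real j * u))) \<partial>lborel)"
      by (intro Bochner_Integration.integral_cong)
         (auto simp: e_def Y_def indicator_def simp flip: exp_of_nat_mult)
    also have "\<dots> = \<mu> j" using mu by (rule has_bochner_integral_integral_eq)
    finally have *: "(\<integral>u. e u * Y u ^ j \<partial>lborel) = \<mu> j" .
    have "\<forall>\<^sub>F s in at_right 0. (\<Sum>n. w s n * real n powr (- (real j * s))) =
        (\<integral>n. w s n * X s n ^ j \<partial>count_space UNIV)"
      using pos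
    proof eventually_elim
      case (elim s)
      \<comment> \<open>For \<open>n = 0\<close> and \<open>j = 0\<close> the powers disagree:
        \<open>0 powr 0\<close> is 0 while \<open>0 ^ 0\<close> is 1. The condition
        \<open>w s 0 = 0\<close> repairs this.\<close>
      have "w s n * real n powr (- (real j * s)) = w s n * (real n powr (- s)) ^ j" for n
        using w[OF elim] by (cases "n = 0") (auto simp: powr_power)
      then have "(\<Sum>n. w s n * real n powr (- (real j * s))) = (\<Sum>n. w s n * (real n powr (- s)) ^ j)"
        by (rule suminf_cong)
      also have "\<dots> = (\<integral>n. w s n * X s n ^ j \<partial>count_space UNIV)"
        by (rule int[OF elim, where B = 1 and f = "\<lambda>x. x ^ j", symmetric]) (auto simp: power_le_one)
      finally show ?case .
    qed
    with mom[of j] show "((\<lambda>s. \<integral>n. w s n * X s n ^ j \<partial>count_space UNIV)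
         \<longlongrightarrow> (\<integral>u. e u * Y u ^ j \<partial>lborel)) (at_right 0)"
      unfolding * by (rule Lim_transform_eventually)
  qed
  also have "(\<integral>u. e u * (if Y u < exp (- 1) then g1 (Y u) else g2 (Y u)) \<partial>lborel) =
      (\<integral>u. indicator {0<..} u *
              (\<rho> u * (if u > 1 then g1 (exp (- u)) else g2 (exp (- u)))) \<partial>lborel)"
    by (intro Bochner_Integration.integral_cong) (auto simp: e_def Y_def indicator_def)
  also have "\<dots> = J" using J by (rule has_bochner_integral_integral_eq)
  finally have "((\<lambda>s. \<integral>n. w s n * (if X s n < exp (- 1) then g1 (X s n) else g2 (X s n)) \<partial>count_space UNIV)
           \<longlongrightarrow> J) (at_right 0)" .
  moreover have "\<forall>\<^sub>F s in at_right 0.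
      (\<integral>n. w s n * (if X s n < exp (- 1) then g1 (X s n) else g2 (X s n)) \<partial>count_space UNIV) =
      (\<Sum>n. w s n * (if real n powr (- s) < exp (- 1) then g1 (real n powr (- s)) else g2 (real n powr (- s))))"
    using pos
  proof eventually_elim
    case (elim s)
    show ?case
    proof (rule int[OF elim, where B = "B1 + B2"])
      show "(\<lambda>t. if t < exp (- 1) then g1 t else g2 t) \<in> borel_measurable borel" by measurable
      show "\<bar>if t < exp (- 1) then g1 t else g2 t\<bar> \<le> B1 + B2" if "t \<in> {0..1}" for t
        using B1(1) B2(1) B1(2)[OF that] B2(2)[OF that] by auto
    qed
  qed
  ultimately show ?thesis by (rule Lim_transform_eventually)
qed

section \<open>The choice s = 1 / ln N: sums over primes and over integers\<close>

lemma filterlim_inverse_ln: "filterlim (\<lambda>N. 1 / ln (real N)) (at_right 0) sequentially"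
  by real_asymp

text \<open>At \<open>n = N\<close> the power equals \<open>exp (- 1)\<close> exactly; the strict
  inequality keeps \<open>N\<close> on the side of the finite sums.\<close>

lemma powr_inverse_ln_less_iff:
  assumes "n \<ge> 1" "N \<ge> 2"
  shows "real n powr (- (1 / ln (real N))) < exp (- 1) \<longleftrightarrow> N < n"
proof -
  have "real n powr (- (1 / ln (real N))) = exp (- (ln (real n) / ln (real N)))"
    using assms by (simp add: powr_def)
  then show ?thesis using assms by (simp add: field_simps)
qed

text \<open>Karamata's method with the masses
  \<open>n powr (- (1 + s)) - n powr (- (1 + 2 * s))\<close>, whose total tends to
  \<open>\<theta> * ln 2\<close>. The limiting integral is \<theta> times that of
  \<open>has_bochner_integral_euler_mascheroni\<close>.\<close>

lemma dseries_truncation: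
  assumes A: "A \<subseteq> {p. prime p}" "has_prime_density A \<theta>" and \<theta>: "0 < \<theta>"
  shows "(\<lambda>N. dseries A (1 + 1 / ln (real N)) - (\<Sum>p\<in>{p \<in> A. p \<le> N}. 1 / real p))
           \<longlonglongrightarrow> - euler_mascheroni * \<theta>"
proof -
  define w where "w s n = indicator A n * (real n powr (- (1 + s)) - real n powr (- (1 + 2 * s)))"
    for s and n :: nat
  \<comment> \<open>With \<open>t = real n powr (- s)\<close> the mass is
    \<open>(t - t * t) / n\<close>. Multiplied by \<open>1 / (1 - t)\<close> it becomes the series
    term \<open>t / n\<close>, wanted for \<open>n > N\<close>; multiplied by \<open>- 1 / t\<close>
    it becomes \<open>t / n - 1 / n\<close>, wanted for \<open>n \<le> N\<close>. The clamps at
    \<open>exp (- 1)\<close> make both functions continuous and change nothing on the side where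
    each is used.\<close>
  define g1 g2 :: "real \<Rightarrow> real"
    where "g1 t = 1 / (1 - min t (exp (- 1)))" and "g2 t = - 1 / max t (exp (- 1))" for t
  have 0: "0 \<notin> A" using A(1) by (metis mem_Collect_eq not_prime_0 subsetD)
  have lim: "((\<lambda>s. \<Sum>n. w s n * (if real n powr (- s) < exp (- 1) then g1 (real n powr (- s))
             else g2 (real n powr (- s)))) \<longlongrightarrow> \<theta> * - euler_mascheroni) (at_right 0)"
  proof (rule discrete_weighted_limit[where \<rho> = "\<lambda>u. \<theta> * ((exp (- u) - exp (- (2 * u))) / u)"
        and \<mu> = "\<lambda>j. \<theta> * ln ((2 + real j) / (1 + real j))"])
    fix s :: real assume s: "s > 0"
    have "real n powr (- (1 + 2 * s)) \<le> real n powr (- (1 + s))" for n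
      using s by (cases "n = 0") (auto intro!: powr_mono)
    moreover have "summable (w s)" unfolding w_def
      using dseries_diff[of s "2 * s" A] s by (auto simp: summable_def)
    ultimately show "(\<forall>n. 0 \<le> w s n) \<and> w s 0 = 0 \<and> summable (w s)"
      using 0 by (simp add: w_def)
  next
    fix u :: real assume "u > 0"
    then show "0 \<le> \<theta> * ((exp (- u) - exp (- (2 * u))) / u)" using \<theta> by simp
  next
    fix j :: nat
    have "has_bochner_integral lborel (\<lambda>u. \<theta> * (indicator {0<..} u *
        ((exp (- ((1 + real j) * u)) - exp (- ((2 + real j) * u))) / u))) (\<theta> * ln ((2 + real j) / (1 + real j)))"
      by (intro has_bochner_integral_mult_right has_bochner_integral_Frullani_exp) auto
    then show "has_bochner_integral lborel (\<lambda>u. indicator {0<..} u *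
        (\<theta> * ((exp (- u) - exp (- (2 * u))) / u) * exp (- (real j * u)))) (\<theta> * ln ((2 + real j) / (1 + real j)))"
      by (rule has_bochner_integral_cong[THEN iffD1, rotated -1])
         (auto simp: field_simps simp flip: exp_add)
    have "\<forall>\<^sub>F s in at_right 0. dseries A (1 + (1 + real j) * s) - dseries A (1 + (2 + real j) * s) =
        (\<Sum>n. w s n * real n powr (- (real j * s)))"
      using eventually_at_right_less[of 0]
    proof eventually_elim
      case (elim s)
      have "(\<lambda>n. indicator A n * (real n powr (- (1 + (1 + real j) * s)) - real n powr (- (1 + (2 + real j) * s))))
         sums (dseries A (1 + (1 + real j) * s) - dseries A (1 + (2 + real j) * s))"
        by (rule dseries_diff) (use elim in \<open>auto intro!: mult_pos_pos\<close>)
      moreover have "w s n * real n powr (- (real j * s)) =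
          indicator A n * (real n powr (- (1 + (1 + real j) * s)) - real n powr (- (1 + (2 + real j) * s)))" for n
        unfolding w_def by (simp add: algebra_simps flip: powr_add)
      ultimately show ?case by (simp add: sums_unique)
    qed
    moreover have "((\<lambda>s. dseries A (1 + (1 + real j) * s) - dseries A (1 + (2 + real j) * s))
        \<longlongrightarrow> \<theta> * ln ((2 + real j) / (1 + real j))) (at_right 0)"
      by (intro dseries_density_diff A) auto
    ultimately show "((\<lambda>s. \<Sum>n. w s n * real n powr (- (real j * s)))
        \<longlongrightarrow> \<theta> * ln ((2 + real j) / (1 + real j))) (at_right 0)"
      by (rule Lim_transform_eventually[rotated])
  next
    have "min t (exp (- 1)) < 1" for t :: real by (intro min.strict_coboundedI2) simp
    then have "min t (exp (- 1)) \<noteq> 1" for t :: real by (metis less_irrefl)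
    then show "continuous_on UNIV g1" unfolding g1_def by (intro continuous_intros) auto
    have "max t (exp (- 1)) \<noteq> 0" for t :: real
      using exp_gt_zero[of "-1::real"] by (auto simp: max_def simp del: exp_gt_zero)
    then show "continuous_on UNIV g2" unfolding g2_def by (intro continuous_intros) auto
    have "has_bochner_integral lborel
       (\<lambda>u. \<theta> * (indicator {0<..} u * ((exp (- u) - indicator {..1} u) / u))) (\<theta> * - euler_mascheroni)"
      by (intro has_bochner_integral_mult_right has_bochner_integral_euler_mascheroni)
    then show "has_bochner_integral lborel (\<lambda>u. indicator {0<..} u * (\<theta> * ((exp (- u) - exp (- (2 * u))) / u) *
        (if 1 < u then g1 (exp (- u)) else g2 (exp (- u))))) (\<theta> * - euler_mascheroni)"
    proof (rule has_bochner_integral_cong[THEN iffD1, rotated -1])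
      fix u :: real
      have 2: "exp (- (2 * u)) = exp (- u) * exp (- u)" by (simp flip: exp_add)
      show "\<theta> * (indicator {0<..} u * ((exp (- u) - indicator {..1} u) / u)) =
        indicator {0<..} u * (\<theta> * ((exp (- u) - exp (- (2 * u))) / u) *
          (if 1 < u then g1 (exp (- u)) else g2 (exp (- u))))"
      proof (cases "u > 1")
        case True
        then have "exp (- u) < 1" "exp (- u) < exp (- 1)" by auto
        then show ?thesis using True unfolding 2 by (simp add: g1_def field_simps)
      next
        case False
        then show ?thesis unfolding 2 by (cases "u > 0") (auto simp: g2_def field_simps max_def)
      qed
    qed auto
  qed measurable
  have "\<forall>\<^sub>F N in sequentially.
     (\<Sum>n. w (1 / ln (real N)) n * (if real n powr (- (1 / ln (real N))) < exp (- 1)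
         then g1 (real n powr (- (1 / ln (real N)))) else g2 (real n powr (- (1 / ln (real N)))))) =
     dseries A (1 + 1 / ln (real N)) - (\<Sum>p\<in>{p \<in> A. p \<le> N}. 1 / real p)"
    using eventually_ge_at_top[of 2]
  proof eventually_elim
    case (elim N)
    define s where "s = 1 / ln (real N)"
    have s: "s > 0" using elim by (simp add: s_def)
    have "(\<lambda>n. indicator A n * real n powr (- (1 + s)) - (if n \<in> {..N} then indicator A n * (1 / real n) else 0)) sums
         (dseries A (1 + s) - (\<Sum>n\<in>{..N}. indicator A n * (1 / real n)))"
      unfolding dseries_def using s
      by (intro sums_diff summable_sums summable_dseries sums_If_finite_set) auto
    moreover have eq: "w s n * (if real n powr (- s) < exp (- 1) then g1 (real n powr (- s)) else g2 (real n powr (- s))) =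
        indicator A n * real n powr (- (1 + s)) - (if n \<in> {..N} then indicator A n * (1 / real n) else 0)" for n
    proof (cases "n \<in> A")
      case True
      then have "prime n" using A by auto
      then have n: "n \<ge> 2" by (rule prime_ge_2_nat)
      define t where "t = real n powr (- s)"
      have t: "t > 0" using n by (simp add: t_def)
      have "real n powr (- s) < real n powr 0" using n s by (intro powr_less_mono) auto
      then have t1: "t < 1" using n by (simp add: t_def)
      have "real n powr (- (1 + s)) = real n powr ((- s) + (- 1))"
        by (rule arg_cong[where f = "\<lambda>t. real n powr t"]) simp
      also have "\<dots> = t / real n"
        using n unfolding powr_add by (simp add: t_def powr_minus field_simps)
      finally have p1: "real n powr (- (1 + s)) = t / real n" .
      have "real n powr (- (1 + 2 * s)) = real n powr ((- s) + (- s) + (- 1))"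
        by (rule arg_cong[where f = "\<lambda>t. real n powr t"]) simp
      also have "\<dots> = t * t / real n"
        using n unfolding powr_add by (simp add: t_def powr_minus field_simps)
      finally have p2: "real n powr (- (1 + 2 * s)) = t * t / real n" .
      have iff: "t < exp (- 1) \<longleftrightarrow> N < n"
        unfolding t_def s_def using n elim by (intro powr_inverse_ln_less_iff) auto
      show ?thesis
      proof (cases "N < n")
        case True
        then show ?thesis using \<open>n \<in> A\<close> iff t1 n unfolding w_def p1 p2 t_def[symmetric]
          by (simp add: g1_def field_simps)
      next
        case False
        then show ?thesis using \<open>n \<in> A\<close> iff t n unfolding w_def p1 p2 t_def[symmetric]
          by (simp add: g2_def max_def field_simps)
      qed
    qed (simp add: w_def)
    ultimately have "(\<Sum>n. w s n * (if real n powr (- s) < exp (- 1) then g1 (real n powr (- s))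
          else g2 (real n powr (- s)))) = dseries A (1 + s) - (\<Sum>n\<in>{..N}. indicator A n * (1 / real n))"
      unfolding eq by (intro sums_unique[symmetric])
    then show ?case
      unfolding s_def[symmetric] sum_over_primes_le .
  qed
  then have "(\<lambda>N. dseries A (1 + 1 / ln (real N)) - (\<Sum>p\<in>{p \<in> A. p \<le> N}. 1 / real p))
     \<longlonglongrightarrow> \<theta> * - euler_mascheroni"
    by (rule Lim_transform_eventually[OF filterlim_compose[OF lim filterlim_inverse_ln]])
  then show ?thesis by (simp add: mult.commute)
qed

text \<open>Exponentiates \<open>dseries_density_diff\<close> by way of
  \<open>dseries_ln_diff\<close>. At \<open>c = 1 + real j\<close> these ratios are the moments in
  \<open>partial_sum_Karamata\<close>.\<close>

lemma dseries_regularly_varying: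
  assumes "{0, 1} \<subseteq> E" "A \<subseteq> {p. prime p}" "has_prime_density A \<theta>" "c \<ge> 1"
  shows "((\<lambda>s. dseries (exponent_set A E) (1 + c * s) / dseries (exponent_set A E) (1 + s))
           \<longlongrightarrow> c powr (- \<theta>)) (at_right 0)"
proof -
  let ?F = "\<lambda>s. dseries (exponent_set A E) (1 + s)"
  have c: "c > 0" using assms by simp
  have "((\<lambda>s. ln (?F (1 * s)) - ln (?F (c * s))) \<longlongrightarrow> 0 + \<theta> * ln (c / 1)) (at_right 0)"
    using tendsto_add[OF dseries_ln_diff[of E A 1 c] dseries_density_diff[of A \<theta> 1 c]] assms by simp
  then have "((\<lambda>s. exp (- (ln (?F (1 * s)) - ln (?F (c * s))))) \<longlongrightarrow> exp (- (0 + \<theta> * ln (c / 1)))) (at_right 0)"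
    by (intro tendsto_exp tendsto_minus)
  moreover have "\<forall>\<^sub>F s in at_right 0. exp (- (ln (?F (1 * s)) - ln (?F (c * s)))) = ?F (c * s) / ?F s"
    using eventually_at_right_less[of 0]
  proof eventually_elim
    case (elim s)
    have "?F s \<ge> 1" "?F (c * s) \<ge> 1"
      using elim c assms by (auto intro!: dseries_exponent_set_ge_1)
    then show ?case by (simp add: exp_diff)
  qed
  ultimately have "((\<lambda>s. ?F (c * s) / ?F s) \<longlongrightarrow> exp (- (0 + \<theta> * ln (c / 1)))) (at_right 0)"
    by (rule Lim_transform_eventually)
  then show ?thesis using c by (simp add: powr_def)
qed

text \<open>In the variable \<open>u\<close> the limit measure is the Gamma distribution of shape
  \<theta>, recognised by its moments \<open>(1 + real j) powr (- \<theta>)\<close>. Undoing the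
  factor \<open>exp (- u)\<close> for \<open>u \<le> 1\<close> leaves the integral of
  \<open>u powr (\<theta> - 1) / Gamma \<theta>\<close> over the unit interval, which is
  \<open>1 / (\<theta> * Gamma \<theta>)\<close>.\<close>

lemma partial_sum_Karamata:
  assumes E: "{0, 1} \<subseteq> E" and A: "A \<subseteq> {p. prime p}" "has_prime_density A \<theta>" and \<theta>: "0 < \<theta>"
  shows "(\<lambda>N. (\<Sum>n\<in>{n \<in> exponent_set A E. n \<le> N}. 1 / real n) /
            dseries (exponent_set A E) (1 + 1 / ln (real N))) \<longlonglongrightarrow> 1 / Gamma (\<theta> + 1)"
proof -
  define M where "M = exponent_set A E"
  define w where "w s n = indicator M n * real n powr (- (1 + s)) / dseries M (1 + s)" for s and n :: nat
  \<comment> \<open>For \<open>n \<le> N\<close> this multiplies \<open>n powr (- (1 + s))\<close>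
    by \<open>n powr s\<close> and so recovers \<open>1 / n\<close>; the zero function on the other
    side cuts the series at \<open>N\<close>.\<close>
  define g2 :: "real \<Rightarrow> real" where "g2 t = 1 / max t (exp (- 1))" for t
  have F1: "dseries M (1 + s) \<ge> 1" if "s > 0" for s
    unfolding M_def using that E by (intro dseries_exponent_set_ge_1) auto
  have G: "Gamma \<theta> > 0" "Gamma (\<theta> + 1) = \<theta> * Gamma \<theta>"
    using \<theta> Gamma_plus1_over[OF \<theta>] by (auto intro!: Gamma_real_pos simp: add.commute)
  have lim: "((\<lambda>s. \<Sum>n. w s n * (if real n powr (- s) < exp (- 1) then (\<lambda>_. 0) (real n powr (- s))
             else g2 (real n powr (- s)))) \<longlongrightarrow> 1 / Gamma (\<theta> + 1)) (at_right 0)"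
  proof (rule discrete_weighted_limit[where \<rho> = "\<lambda>u. u powr (\<theta> - 1) * exp (- u) / Gamma \<theta>"
        and \<mu> = "\<lambda>j. (1 + real j) powr (- \<theta>)"])
    fix s :: real assume s: "s > 0"
    have "summable (w s)"
      unfolding w_def by (rule summable_divide, rule summable_dseries) (use s in simp)
    moreover have "0 \<le> w s n" for n unfolding w_def using F1[OF s] by simp
    ultimately show "(\<forall>n. 0 \<le> w s n) \<and> w s 0 = 0 \<and> summable (w s)"
      by (simp add: w_def)
  next
    fix u :: real assume "u > 0"
    then show "0 \<le> u powr (\<theta> - 1) * exp (- u) / Gamma \<theta>" using G by simp
  next
    fix j :: nat
    have "has_bochner_integral lborel (\<lambda>u. inverse (Gamma \<theta>) * (indicator {0<..} u *
        (u powr (\<theta> - 1) * exp (- ((1 + real j) * u))))) (inverse (Gamma \<theta>) * (Gamma \<theta> * (1 + real j) powr (- \<theta>)))"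
      using \<theta> by (intro has_bochner_integral_mult_right has_bochner_integral_Gamma) auto
    also have "inverse (Gamma \<theta>) * (Gamma \<theta> * (1 + real j) powr (- \<theta>)) = (1 + real j) powr (- \<theta>)"
      using G by simp
    finally show "has_bochner_integral lborel (\<lambda>u. indicator {0<..} u *
        (u powr (\<theta> - 1) * exp (- u) / Gamma \<theta> * exp (- (real j * u)))) ((1 + real j) powr (- \<theta>))"
      by (rule has_bochner_integral_cong[THEN iffD1, rotated -1])
         (auto simp: field_simps simp flip: exp_add)
    have "\<forall>\<^sub>F s in at_right 0. dseries M (1 + (1 + real j) * s) / dseries M (1 + s) =
        (\<Sum>n. w s n * real n powr (- (real j * s)))"
      using eventually_at_right_less[of 0]
    proof eventually_elim
      case (elim s)
      have "(\<lambda>n. indicator M n * real n powr (- (1 + (1 + real j) * s)) / dseries M (1 + s))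
         sums (dseries M (1 + (1 + real j) * s) / dseries M (1 + s))"
        unfolding dseries_def[of M "1 + (1 + real j) * s"]
        by (intro sums_divide summable_sums summable_dseries) (use elim in \<open>auto intro!: mult_pos_pos\<close>)
      moreover have "w s n * real n powr (- (real j * s)) =
          indicator M n * real n powr (- (1 + (1 + real j) * s)) / dseries M (1 + s)" for n
        unfolding w_def by (simp add: algebra_simps flip: powr_add)
      ultimately show ?case by (simp add: sums_unique)
    qed
    moreover have "((\<lambda>s. dseries M (1 + (1 + real j) * s) / dseries M (1 + s))
        \<longlongrightarrow> (1 + real j) powr (- \<theta>)) (at_right 0)"
      unfolding M_def by (intro dseries_regularly_varying E A) auto
    ultimately show "((\<lambda>s. \<Sum>n. w s n * real n powr (- (real j * s)))
        \<longlongrightarrow> (1 + real j) powr (- \<theta>)) (at_right 0)"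
      by (rule Lim_transform_eventually[rotated])
  next
    have "max t (exp (- 1)) \<noteq> 0" for t :: real
      using exp_gt_zero[of "-1::real"] by (auto simp: max_def simp del: exp_gt_zero)
    then show "continuous_on UNIV g2" unfolding g2_def by (intro continuous_intros) auto
    have "has_bochner_integral lborel
       (\<lambda>u. inverse (Gamma \<theta>) * (indicator {0..1} u * u powr (\<theta> - 1))) (inverse (Gamma \<theta>) * (1 / \<theta>))"
      using \<theta> by (intro has_bochner_integral_mult_right has_bochner_integral_powr_unit)
    also have "inverse (Gamma \<theta>) * (1 / \<theta>) = 1 / Gamma (\<theta> + 1)"
      using G by (simp add: field_simps)
    finally show "has_bochner_integral lborel (\<lambda>u. indicator {0<..} u * (u powr (\<theta> - 1) * exp (- u) / Gamma \<theta> *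
        (if 1 < u then (\<lambda>_. 0) (exp (- u)) else g2 (exp (- u))))) (1 / Gamma (\<theta> + 1))"
      by (rule has_bochner_integral_cong[THEN iffD1, rotated -1])
         (auto simp: g2_def max_def indicator_def field_simps simp flip: exp_add)
  qed auto
  have "\<forall>\<^sub>F N in sequentially.
     (\<Sum>n. w (1 / ln (real N)) n * (if real n powr (- (1 / ln (real N))) < exp (- 1)
         then (\<lambda>_. 0) (real n powr (- (1 / ln (real N)))) else g2 (real n powr (- (1 / ln (real N)))))) =
     (\<Sum>n\<in>{n \<in> M. n \<le> N}. 1 / real n) / dseries M (1 + 1 / ln (real N))"
    using eventually_ge_at_top[of 2]
  proof eventually_elim
    case (elim N)
    define s where "s = 1 / ln (real N)"
    have "(\<lambda>n. if n \<in> {..N} then indicator M n * (1 / real n) / dseries M (1 + s) else 0) sums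
         (\<Sum>n\<in>{..N}. indicator M n * (1 / real n) / dseries M (1 + s))"
      by (intro sums_If_finite_set) auto
    moreover have eq: "w s n * (if real n powr (- s) < exp (- 1) then (\<lambda>_. 0) (real n powr (- s))
          else g2 (real n powr (- s))) =
        (if n \<in> {..N} then indicator M n * (1 / real n) / dseries M (1 + s) else 0)" for n
    proof (cases "n \<in> M")
      case True
      then have n: "n \<ge> 1" by (simp add: M_def exponent_set_def Suc_le_eq)
      define t where "t = real n powr (- s)"
      have t: "t > 0" using n by (simp add: t_def)
      have "real n powr (- (1 + s)) = real n powr ((- s) + (- 1))"
        by (rule arg_cong[where f = "\<lambda>t. real n powr t"]) simp
      also have "\<dots> = t / real n"
        using n unfolding powr_add by (simp add: t_def powr_minus field_simps)
      finally have p1: "real n powr (- (1 + s)) = t / real n" .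
      have iff: "t < exp (- 1) \<longleftrightarrow> N < n"
        unfolding t_def s_def using n elim by (intro powr_inverse_ln_less_iff) auto
      then show ?thesis using True t n unfolding w_def p1 t_def[symmetric]
        by (auto simp: g2_def max_def field_simps)
    qed (simp add: w_def)
    ultimately have "(\<Sum>n. w s n * (if real n powr (- s) < exp (- 1) then (\<lambda>_. 0) (real n powr (- s))
          else g2 (real n powr (- s)))) = (\<Sum>n\<in>{..N}. indicator M n * (1 / real n) / dseries M (1 + s))"
      unfolding eq by (intro sums_unique[symmetric])
    then show ?case
      unfolding s_def[symmetric] sum_over_primes_le by (simp add: sum_divide_distrib)
  qed
  then show ?thesis unfolding M_def
    by (rule Lim_transform_eventually[OF filterlim_compose[OF lim filterlim_inverse_ln], unfolded M_def])
qed

text \<open>The logarithm of the product exceeds the sum of \<open>1 / p\<close> over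
  \<open>p \<le> N\<close> by a partial sum of the remainder series at 0. The logarithm of the
  Dirichlet series exceeds its prime series by the remainder at \<open>1 / ln N\<close>. Both tend
  to \<open>euler_remainder A E 0\<close>, so only \<open>dseries_truncation\<close>
  contributes.\<close>

lemma euler_product_asymp:
  assumes E: "{0, 1} \<subseteq> E" and A: "A \<subseteq> {p. prime p}" "has_prime_density A \<theta>" and \<theta>: "0 < \<theta>"
  shows "(\<lambda>N. (\<Sum>\<^sub>\<infinity>n\<in>exponent_set {p \<in> A. p \<le> N} E. 1 / real n) /
            dseries (exponent_set A E) (1 + 1 / ln (real N))) \<longlonglongrightarrow> exp (euler_mascheroni * \<theta>)"
proof -
  define P where "P N = (\<Sum>\<^sub>\<infinity>n\<in>exponent_set {p \<in> A. p \<le> N} E. 1 / real n)" for N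
  let ?l = "\<lambda>p. local_factor E (1 / real p)"
  have P: "P N = (\<Prod>p\<in>{p \<in> A. p \<le> N}. ?l p)" for N
  proof -
    have "((\<lambda>n. real n powr (- 1)) has_sum (\<Prod>p\<in>{p \<in> A. p \<le> N}. local_factor E (real p powr (- 1))))
        (exponent_set {p \<in> A. p \<le> N} E)"
      using A by (intro has_sum_exponent_set_finite) auto
    then show ?thesis by (simp add: P_def infsumI powr_minus_divide)
  qed
  have pos: "?l p > 0" if "p \<in> A" for p
  proof -
    have "p \<ge> 2" using that A(1) prime_ge_2_nat by auto
    then have "1 + 1 / real p \<le> ?l p" using E by (intro local_factor_bounds) auto
    moreover have "0 \<le> 1 / real p" by simp
    ultimately show ?thesis by linarith
  qed
  have Ppos: "P N > 0" for N unfolding P using pos by (intro prod_pos) auto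
  have lnP: "ln (P N) - (\<Sum>p\<in>{p \<in> A. p \<le> N}. 1 / real p) =
      (\<Sum>p\<le>N. indicator A p * (ln (?l p) - 1 / real p))" for N
  proof -
    have "ln (P N) = (\<Sum>p\<in>{p \<in> A. p \<le> N}. ln (?l p))"
      unfolding P by (intro ln_prod) (auto dest: pos)
    then have "ln (P N) - (\<Sum>p\<in>{p \<in> A. p \<le> N}. 1 / real p) =
        (\<Sum>p\<in>{p \<in> A. p \<le> N}. ln (?l p) - 1 / real p)"
      by (simp add: sum_subtractf)
    then show ?thesis by (simp add: sum_over_primes_le)
  qed
  have "(\<lambda>p. indicator A p * (ln (?l p) - 1 / real p)) sums euler_remainder A E 0"
    using euler_remainder_sums[OF E A(1), of 0] by (simp add: powr_minus_divide)
  then have 1: "(\<lambda>N. ln (P N) - (\<Sum>p\<in>{p \<in> A. p \<le> N}. 1 / real p)) \<longlonglongrightarrow> euler_remainder A E 0"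
    unfolding lnP by (simp add: sums_def_le)
  have 2: "(\<lambda>N. euler_remainder A E (1 / ln (real N))) \<longlonglongrightarrow> euler_remainder A E 0"
    by (rule filterlim_compose[OF tendsto_euler_remainder[OF E A(1)] filterlim_inverse_ln])
  have "(\<lambda>N. exp ((ln (P N) - (\<Sum>p\<in>{p \<in> A. p \<le> N}. 1 / real p)) - euler_remainder A E (1 / ln (real N)) -
      (dseries A (1 + 1 / ln (real N)) - (\<Sum>p\<in>{p \<in> A. p \<le> N}. 1 / real p))))
      \<longlonglongrightarrow> exp (euler_remainder A E 0 - euler_remainder A E 0 - - euler_mascheroni * \<theta>)"
    by (intro tendsto_exp tendsto_diff 1 2 dseries_truncation A \<theta>)
  moreover have "\<forall>\<^sub>F N in sequentially.
      exp ((ln (P N) - (\<Sum>p\<in>{p \<in> A. p \<le> N}. 1 / real p)) - euler_remainder A E (1 / ln (real N)) -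
      (dseries A (1 + 1 / ln (real N)) - (\<Sum>p\<in>{p \<in> A. p \<le> N}. 1 / real p))) =
      P N / dseries (exponent_set A E) (1 + 1 / ln (real N))"
    using eventually_ge_at_top[of 2]
  proof eventually_elim
    case (elim N)
    define s where "s = 1 / ln (real N)"
    have s: "s > 0" using elim by (simp add: s_def)
    have F: "dseries (exponent_set A E) (1 + s) \<ge> 1"
      using s E by (intro dseries_exponent_set_ge_1) auto
    have "(ln (P N) - (\<Sum>p\<in>{p \<in> A. p \<le> N}. 1 / real p)) - euler_remainder A E s -
      (dseries A (1 + s) - (\<Sum>p\<in>{p \<in> A. p \<le> N}. 1 / real p)) =
      ln (P N) - ln (dseries (exponent_set A E) (1 + s))"
      using ln_dseries_eq[OF E A(1) s] by simp
    then show ?case using F Ppos[of N] by (simp add: s_def exp_diff)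
  qed
  ultimately have "(\<lambda>N. P N / dseries (exponent_set A E) (1 + 1 / ln (real N)))
      \<longlonglongrightarrow> exp (euler_remainder A E 0 - euler_remainder A E 0 - - euler_mascheroni * \<theta>)"
    by (rule Lim_transform_eventually)
  then show ?thesis by (simp add: P_def)
qed

text \<open>Numerator and denominator are measured against the same value of the Dirichlet series,
  which is at least 1 and cancels.\<close>

lemma exponent_set_ratio:
  assumes E: "{0, 1} \<subseteq> E" and A: "A \<subseteq> {p. prime p}" "has_prime_density A \<theta>" and \<theta>: "0 < \<theta>"
  shows "(\<lambda>N. (\<Sum>\<^sub>\<infinity>n\<in>exponent_set {p \<in> A. p \<le> N} E. 1 / real n) /
            (\<Sum>n\<in>{n \<in> exponent_set A E. n \<le> N}. 1 / real n))
           \<longlonglongrightarrow> exp (euler_mascheroni * \<theta>) * Gamma (\<theta> + 1)"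
proof -
  have G: "Gamma (\<theta> + 1) > 0" using \<theta> by (intro Gamma_real_pos) auto
  have "(\<lambda>N. ((\<Sum>\<^sub>\<infinity>n\<in>exponent_set {p \<in> A. p \<le> N} E. 1 / real n) /
            dseries (exponent_set A E) (1 + 1 / ln (real N))) /
         ((\<Sum>n\<in>{n \<in> exponent_set A E. n \<le> N}. 1 / real n) /
            dseries (exponent_set A E) (1 + 1 / ln (real N))))
      \<longlonglongrightarrow> exp (euler_mascheroni * \<theta>) / (1 / Gamma (\<theta> + 1))"
    using G by (intro tendsto_divide euler_product_asymp partial_sum_Karamata assms) auto
  moreover have "\<forall>\<^sub>F N in sequentially.
      ((\<Sum>\<^sub>\<infinity>n\<in>exponent_set {p \<in> A. p \<le> N} E. 1 / real n) /
            dseries (exponent_set A E) (1 + 1 / ln (real N))) /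
         ((\<Sum>n\<in>{n \<in> exponent_set A E. n \<le> N}. 1 / real n) /
            dseries (exponent_set A E) (1 + 1 / ln (real N))) =
      (\<Sum>\<^sub>\<infinity>n\<in>exponent_set {p \<in> A. p \<le> N} E. 1 / real n) /
            (\<Sum>n\<in>{n \<in> exponent_set A E. n \<le> N}. 1 / real n)"
    using eventually_ge_at_top[of 2]
  proof eventually_elim
    case (elim N)
    have "dseries (exponent_set A E) (1 + 1 / ln (real N)) \<ge> 1"
      using elim E by (intro dseries_exponent_set_ge_1) auto
    then show ?case by simp
  qed
  ultimately have "(\<lambda>N. (\<Sum>\<^sub>\<infinity>n\<in>exponent_set {p \<in> A. p \<le> N} E. 1 / real n) /
            (\<Sum>n\<in>{n \<in> exponent_set A E. n \<le> N}. 1 / real n))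
      \<longlonglongrightarrow> exp (euler_mascheroni * \<theta>) / (1 / Gamma (\<theta> + 1))"
    by (rule Lim_transform_eventually)
  then show ?thesis by simp
qed

section \<open>Specialisation to all integers and to k-free integers\<close>

lemma integers_over_eq_exponent_set: "integers_over P = exponent_set P UNIV"
proof -
  have "multiplicity p n \<in> (if p \<in> P then UNIV else {0}) \<longleftrightarrow> (p dvd n \<longrightarrow> p \<in> P)"
    if "prime p" "n > 0" for p n :: nat
  proof -
    have "multiplicity p n = 0 \<longleftrightarrow> \<not> p dvd n"
      using that by (intro prime_elem_multiplicity_eq_zero_iff) auto
    then show ?thesis by auto
  qed
  then show ?thesis unfolding integers_over_def exponent_set_def by blast
qed

text \<open>Divisibility by \<open>p ^ k\<close> means \<open>k \<le> multiplicity p n\<close>. At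
  primes outside \<open>P\<close> the multiplicity is 0, and there \<open>k \<ge> 1\<close> rules
  the divisibility out.\<close>

lemma k_free_integers_over_eq_exponent_set:
  assumes "k \<ge> 1"
  shows "{n \<in> integers_over P. k_free k n} = exponent_set P {..<k}"
proof -
  have "multiplicity p n \<in> (if p \<in> P then {..<k} else {0}) \<longleftrightarrow>
      multiplicity p n \<in> (if p \<in> P then UNIV else {0}) \<and> \<not> p ^ k dvd n"
    if "prime p" "n > 0" for p n :: nat
  proof -
    have "p ^ k dvd n \<longleftrightarrow> k \<le> multiplicity p n"
      using that by (intro power_dvd_iff_le_multiplicity) auto
    then show ?thesis using assms by auto
  qed
  then show ?thesis
    unfolding integers_over_eq_exponent_set k_free_def exponent_set_def by blast
qed

theorem theorem1:
  fixes A :: "nat set" and \<theta> :: real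
  assumes "A \<subseteq> {p. prime p}"
    and "has_prime_density A \<theta>"
    and "0 < \<theta>" and "\<theta> \<le> 1"
  shows "((\<lambda>N::nat. (\<Sum>\<^sub>\<infinity>n\<in>integers_over {p \<in> A. p \<le> N}. 1 / real n) /
                 (\<Sum>n\<in>{n \<in> integers_over A. n \<le> N}. 1 / real n))
            \<longlonglongrightarrow> exp (euler_mascheroni * \<theta>) * Gamma (\<theta> + 1)) \<and>
         (\<forall>k\<ge>2.
           (\<lambda>N::nat. (\<Sum>\<^sub>\<infinity>n\<in>{n \<in> integers_over {p \<in> A. p \<le> N}. k_free k n}. 1 / real n) /
                 (\<Sum>n\<in>{n \<in> integers_over A. n \<le> N \<and> k_free k n}. 1 / real n))
            \<longlonglongrightarrow> exp (euler_mascheroni * \<theta>) * Gamma (\<theta> + 1))"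
proof (intro conjI allI impI)
  show "(\<lambda>N::nat. (\<Sum>\<^sub>\<infinity>n\<in>integers_over {p \<in> A. p \<le> N}. 1 / real n) /
                 (\<Sum>n\<in>{n \<in> integers_over A. n \<le> N}. 1 / real n))
            \<longlonglongrightarrow> exp (euler_mascheroni * \<theta>) * Gamma (\<theta> + 1)"
    unfolding integers_over_eq_exponent_set using assms by (intro exponent_set_ratio) auto
next
  fix k :: nat assume k: "k \<ge> 2"
  then have eq: "{n \<in> integers_over P. k_free k n} = exponent_set P {..<k}" for P
    by (intro k_free_integers_over_eq_exponent_set) simp
  have eq': "{n \<in> integers_over A. n \<le> N \<and> k_free k n} = {n \<in> exponent_set A {..<k}. n \<le> N}" for N
    unfolding eq[symmetric] by auto
  show "(\<lambda>N::nat. (\<Sum>\<^sub>\<infinity>n\<in>{n \<in> integers_over {p \<in> A. p \<le> N}. k_free k n}. 1 / real n) /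
                 (\<Sum>n\<in>{n \<in> integers_over A. n \<le> N \<and> k_free k n}. 1 / real n))
            \<longlonglongrightarrow> exp (euler_mascheroni * \<theta>) * Gamma (\<theta> + 1)"
    \<comment> \<open>\<open>k \<ge> 2\<close> places both exponents 0 and 1 in
      \<open>{..<k}\<close>, as the estimate of the Euler factors requires.\<close>
    unfolding eq eq' using assms k by (intro exponent_set_ratio) auto
qed

end
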